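(* Let $(\mathcal U,\mathcal V)$ be a cotorsion pair in a triangulated category $\mathcal T$. Then the heart $\underline{\mathcal H}$ of $(\mathcal U,\mathcal V)$ is naturally equivalent to $\mathsf{lex}\,\mathcal U$.
   Context: All categories and functors are additive; subcategories are full, additive and closed under isomorphisms. $\mathcal T$ is a triangulated category with translation $[1]$. A pair $(\mathcal U,\mathcal V)$ of full subcategories of $\mathcal T$, both closed under direct summands, is a cotorsion pair if $\mathcal T(U,V[1])=0$ for all $U\in\mathcal U$, $V\in\mathcal V$, and every object $X\in\mathcal T$ admits a triangle $U\to X\to V[1]\to U[1]$ with $U\in\mathcal U$, $V\in\mathcal V$. The extension-closed subcategory $\mathcal U$ is an extriangulated category with $\mathbb E(X,Z)=\mathcal T(X,Z[1])$: a conflation in $\mathcal U$ is a sequence $Z\to Y\to X$ of objects of $\mathcal U$ that completes to a triangle $Z\to Y\to X\to Z[1]$ in $\mathcal T$. $\operatorname{mod}\mathcal U$ is the category of finitely presented contravariant functors $F:\mathcal U\to\mathsf{Ab}$, i.e. those with an exact sequence $\mathcal U(-,U_1)\to\mathcal U(-,U_0)\to F\to0$. $\mathsf{lex}\,\mathcal U$ is the full subcategory of $\operatorname{mod}\mathcal U$ of left exact functors: those $F$ such that $0\to F(X)\to F(Y)\to F(Z)$ is exact for every conflation $Z\to Y\to X$ in $\mathcal U$. For classes $\mathcal A,\mathcal B$ of objects, $\mathcal A*\mathcal B$ is the class of objects $X$ in a triangle $A\to X\to B\to A[1]$ with $A\in\mathcal A$, $B\in\mathcal B$. Put $\mathcal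 W=\mathcal U\cap\mathcal V$, $\mathcal T^+=\mathcal W*\mathcal V[1]$, $\mathcal T^-=\mathcal U[-1]*\mathcal W$, $\mathcal H=\mathcal T^+\cap\mathcal T^-$. The heart is $\underline{\mathcal H}=\mathcal H/[\mathcal W]$, the quotient of $\mathcal H$ by the ideal of morphisms factoring through an object of $\mathcal W$. *)

theory Defs
  imports "HOL-Algebra.Coset"
begin

section \<open>Additive categories\<close>

text \<open>
  Hom-sets are abelian groups in the sense of \<^const>\<open>comm_group\<close>. They are therefore written
  multiplicatively: \<open>\<otimes>\<close> is the sum of morphisms, \<open>\<one>\<close> the zero morphism and \<open>inv\<close> the negative.
  Hom-sets need not be disjoint, so composition carries its three objects:
  \<open>cmp C X Y Z g f\<close> is the composite of \<open>f : X \<rightarrow> Y\<close> with \<open>g : Y \<rightarrow> Z\<close>.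
\<close>

record ('o, 'm) acat =
  obj :: "'o set"
  Mor :: "'o \<Rightarrow> 'o \<Rightarrow> 'm monoid"
  ident :: "'o \<Rightarrow> 'm"
  cmp :: "'o \<Rightarrow> 'o \<Rightarrow> 'o \<Rightarrow> 'm \<Rightarrow> 'm \<Rightarrow> 'm"

abbreviation arr :: "('o, 'm, 'x) acat_scheme \<Rightarrow> 'o \<Rightarrow> 'o \<Rightarrow> 'm set" where
  "arr C X Y \<equiv> carrier (Mor C X Y)"

locale preadditive_category =
  fixes C :: "('o, 'm, 'x) acat_scheme"
  assumes Mor_comm_group:
      "\<lbrakk>X \<in> obj C; Y \<in> obj C\<rbrakk> \<Longrightarrow> comm_group (Mor C X Y)"
    and ident_closed:
      "X \<in> obj C \<Longrightarrow> ident C X \<in> arr C X X"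
    and cmp_closed:
      "\<lbrakk>X \<in> obj C; Y \<in> obj C; Z \<in> obj C; f \<in> arr C X Y; g \<in> arr C Y Z\<rbrakk>
        \<Longrightarrow> cmp C X Y Z g f \<in> arr C X Z"
    and cmp_ident_left:
      "\<lbrakk>X \<in> obj C; Y \<in> obj C; f \<in> arr C X Y\<rbrakk> \<Longrightarrow> cmp C X Y Y (ident C Y) f = f"
    and cmp_ident_right:
      "\<lbrakk>X \<in> obj C; Y \<in> obj C; f \<in> arr C X Y\<rbrakk> \<Longrightarrow> cmp C X X Y f (ident C X) = f"
    and cmp_assoc:
      "\<lbrakk>X \<in> obj C; Y \<in> obj C; Z \<in> obj C; W \<in> obj C;
        f \<in> arr C X Y; g \<in> arr C Y Z; h \<in> arr C Z W\<rbrakk>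
        \<Longrightarrow> cmp C X Z W h (cmp C X Y Z g f) = cmp C X Y W (cmp C Y Z W h g) f"
    and cmp_add_left:
      "\<lbrakk>X \<in> obj C; Y \<in> obj C; Z \<in> obj C; f \<in> arr C X Y; g \<in> arr C Y Z; g' \<in> arr C Y Z\<rbrakk>
        \<Longrightarrow> cmp C X Y Z (g \<otimes>\<^bsub>Mor C Y Z\<^esub> g') f
            = cmp C X Y Z g f \<otimes>\<^bsub>Mor C X Z\<^esub> cmp C X Y Z g' f"
    and cmp_add_right:
      "\<lbrakk>X \<in> obj C; Y \<in> obj C; Z \<in> obj C; f \<in> arr C X Y; f' \<in> arr C X Y; g \<in> arr C Y Z\<rbrakk>
        \<Longrightarrow> cmp C X Y Z g (f \<otimes>\<^bsub>Mor C X Y\<^esub> f')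
            = cmp C X Y Z g f \<otimes>\<^bsub>Mor C X Z\<^esub> cmp C X Y Z g f'"

definition is_iso :: "('o, 'm, 'x) acat_scheme \<Rightarrow> 'o \<Rightarrow> 'o \<Rightarrow> 'm \<Rightarrow> bool" where
  "is_iso C X Y f \<longleftrightarrow> f \<in> arr C X Y \<and>
     (\<exists>g \<in> arr C Y X. cmp C X Y X g f = ident C X \<and> cmp C Y X Y f g = ident C Y)"

definition isomorphic :: "('o, 'm, 'x) acat_scheme \<Rightarrow> 'o \<Rightarrow> 'o \<Rightarrow> bool" where
  "isomorphic C X Y \<longleftrightarrow> (\<exists>f. is_iso C X Y f)"

definition is_zero_object :: "('o, 'm, 'x) acat_scheme \<Rightarrow> 'o \<Rightarrow> bool" where
  "is_zero_object C Z \<longleftrightarrow> Z \<in> obj C \<and> ident C Z = \<one>\<^bsub>Mor C Z Z\<^esub>"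

definition is_biproduct :: "('o, 'm, 'x) acat_scheme \<Rightarrow> 'o \<Rightarrow> 'o \<Rightarrow> 'o \<Rightarrow> bool" where
  "is_biproduct C X Y P \<longleftrightarrow> P \<in> obj C \<and>
     (\<exists>i \<in> arr C X P. \<exists>j \<in> arr C Y P. \<exists>p \<in> arr C P X. \<exists>q \<in> arr C P Y.
        cmp C X P X p i = ident C X \<and> cmp C Y P Y q j = ident C Y \<and>
        cmp C X P Y q i = \<one>\<^bsub>Mor C X Y\<^esub> \<and> cmp C Y P X p j = \<one>\<^bsub>Mor C Y X\<^esub> \<and>
        cmp C P X P i p \<otimes>\<^bsub>Mor C P P\<^esub> cmp C P Y P j q = ident C P)"

locale additive_category = preadditive_category +
  assumes ex_zero_object: "\<exists>Z. is_zero_object C Z"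
    and ex_biproduct: "\<lbrakk>X \<in> obj C; Y \<in> obj C\<rbrakk> \<Longrightarrow> \<exists>P. is_biproduct C X Y P"

definition op_cat :: "('o, 'm, 'x) acat_scheme \<Rightarrow> ('o, 'm) acat" where
  "op_cat C = \<lparr>obj = obj C, Mor = (\<lambda>X Y. Mor C Y X), ident = ident C,
     cmp = (\<lambda>X Y Z g f. cmp C Z Y X f g)\<rparr>"

definition full_subcat :: "('o, 'm, 'x) acat_scheme \<Rightarrow> 'o set \<Rightarrow> ('o, 'm) acat" where
  "full_subcat C A = \<lparr>obj = A, Mor = Mor C, ident = ident C, cmp = cmp C\<rparr>"

definition additive_subclass :: "('o, 'm, 'x) acat_scheme \<Rightarrow> 'o set \<Rightarrow> bool" where
  "additive_subclass C A \<longleftrightarrow> A \<subseteq> obj C \<and>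
     (\<forall>X \<in> A. \<forall>Y \<in> obj C. isomorphic C X Y \<longrightarrow> Y \<in> A) \<and>
     (\<exists>Z \<in> A. is_zero_object C Z) \<and>
     (\<forall>X \<in> A. \<forall>Y \<in> A. \<forall>P. is_biproduct C X Y P \<longrightarrow> P \<in> A)"

definition closed_under_summands :: "('o, 'm, 'x) acat_scheme \<Rightarrow> 'o set \<Rightarrow> bool" where
  "closed_under_summands C A \<longleftrightarrow>
     (\<forall>P \<in> A. \<forall>X \<in> obj C. \<forall>Y \<in> obj C. is_biproduct C X Y P \<longrightarrow> X \<in> A)"

subsection \<open>The quotient by the ideal of morphisms factoring through a class of objects\<close>

definition factoring :: "('o, 'm, 'x) acat_scheme \<Rightarrow> 'o set \<Rightarrow> 'o \<Rightarrow> 'o \<Rightarrow> 'm set" where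
  "factoring C A X Y = {cmp C X W Y g f | W f g. W \<in> A \<and> f \<in> arr C X W \<and> g \<in> arr C W Y}"

text \<open>
  Morphisms of the quotient are cosets. The union in the composition is a union of equal cosets:
  pairwise composites of representatives alone need not exhaust the coset of the composite.
\<close>

definition quotient_cat :: "('o, 'm, 'x) acat_scheme \<Rightarrow> 'o set \<Rightarrow> ('o, 'm set) acat" where
  "quotient_cat C A = \<lparr>obj = obj C,
     Mor = (\<lambda>X Y. Mor C X Y Mod factoring C A X Y),
     ident = (\<lambda>X. factoring C A X X #>\<^bsub>Mor C X X\<^esub> ident C X),
     cmp = (\<lambda>X Y Z G F. \<Union>g \<in> G. \<Union>f \<in> F. factoring C A X Z #>\<^bsub>Mor C X Z\<^esub> cmp C X Y Z g f)\<rparr>"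


section \<open>Additive functors, natural transformations, equivalences\<close>

record ('o, 'm, 'p, 'n) functr =
  fob :: "'o \<Rightarrow> 'p"
  fmor :: "'o \<Rightarrow> 'o \<Rightarrow> 'm \<Rightarrow> 'n"

definition additive_functor ::
    "('o, 'm, 'x) acat_scheme \<Rightarrow> ('p, 'n, 'y) acat_scheme \<Rightarrow> ('o, 'm, 'p, 'n) functr \<Rightarrow> bool" where
  "additive_functor C D F \<longleftrightarrow>
     (\<forall>X \<in> obj C. fob F X \<in> obj D) \<and>
     (\<forall>X \<in> obj C. \<forall>Y \<in> obj C. fmor F X Y \<in> hom (Mor C X Y) (Mor D (fob F X) (fob F Y))) \<and>
     (\<forall>X \<in> obj C. fmor F X X (ident C X) = ident D (fob F X)) \<and>
     (\<forall>X \<in> obj C. \<forall>Y \<in> obj C. \<forall>Z \<in> obj C. \<forall>f \<in> arr C X Y. \<forall>g \<in> arr C Y Z.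
        fmor F X Z (cmp C X Y Z g f)
          = cmp D (fob F X) (fob F Y) (fob F Z) (fmor F Y Z g) (fmor F X Y f))"

definition id_functor :: "('o, 'm, 'o, 'm) functr" where
  "id_functor = \<lparr>fob = (\<lambda>X. X), fmor = (\<lambda>X Y f. f)\<rparr>"

definition comp_functor ::
    "('p, 'n, 'q, 'k) functr \<Rightarrow> ('o, 'm, 'p, 'n) functr \<Rightarrow> ('o, 'm, 'q, 'k) functr" where
  "comp_functor G F = \<lparr>fob = (\<lambda>X. fob G (fob F X)),
     fmor = (\<lambda>X Y f. fmor G (fob F X) (fob F Y) (fmor F X Y f))\<rparr>"

text \<open>
  Natural transformations are extensional families, so that equality of natural transformations
  is equality of their components at the objects of the source category.
\<close>

definition nat_trans ::
    "('o, 'm, 'x) acat_scheme \<Rightarrow> ('p, 'n, 'y) acat_scheme \<Rightarrow>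
     ('o, 'm, 'p, 'n) functr \<Rightarrow> ('o, 'm, 'p, 'n) functr \<Rightarrow> ('o \<Rightarrow> 'n) set" where
  "nat_trans C D F G =
     {\<eta> \<in> (\<Pi>\<^sub>E X \<in> obj C. arr D (fob F X) (fob G X)).
        \<forall>X \<in> obj C. \<forall>Y \<in> obj C. \<forall>f \<in> arr C X Y.
          cmp D (fob F X) (fob F Y) (fob G Y) (\<eta> Y) (fmor F X Y f)
            = cmp D (fob F X) (fob G X) (fob G Y) (fmor G X Y f) (\<eta> X)}"

definition naturally_isomorphic ::
    "('o, 'm, 'x) acat_scheme \<Rightarrow> ('p, 'n, 'y) acat_scheme \<Rightarrow>
     ('o, 'm, 'p, 'n) functr \<Rightarrow> ('o, 'm, 'p, 'n) functr \<Rightarrow> bool" where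
  "naturally_isomorphic C D F G \<longleftrightarrow>
     (\<exists>\<eta> \<in> nat_trans C D F G. \<forall>X \<in> obj C. is_iso D (fob F X) (fob G X) (\<eta> X))"

definition is_equivalence ::
    "('o, 'm, 'x) acat_scheme \<Rightarrow> ('p, 'n, 'y) acat_scheme \<Rightarrow> ('o, 'm, 'p, 'n) functr \<Rightarrow> bool" where
  "is_equivalence C D F \<longleftrightarrow> additive_functor C D F \<and>
     (\<exists>G. additive_functor D C G \<and>
        naturally_isomorphic C C id_functor (comp_functor G F) \<and>
        naturally_isomorphic D D (comp_functor F G) id_functor)"

definition equivalent_categories ::
    "('o, 'm, 'x) acat_scheme \<Rightarrow> ('p, 'n, 'y) acat_scheme \<Rightarrow> bool" where
  "equivalent_categories C D \<longleftrightarrow> (\<exists>F. is_equivalence C D F)"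

definition functor_cat ::
    "('o, 'm, 'x) acat_scheme \<Rightarrow> ('p, 'n, 'y) acat_scheme \<Rightarrow>
     (('o, 'm, 'p, 'n) functr, 'o \<Rightarrow> 'n) acat" where
  "functor_cat C D = \<lparr>obj = {F. additive_functor C D F},
     Mor = (\<lambda>F G. \<lparr>carrier = nat_trans C D F G,
       mult = (\<lambda>\<eta> \<theta>. \<lambda>X \<in> obj C. \<eta> X \<otimes>\<^bsub>Mor D (fob F X) (fob G X)\<^esub> \<theta> X),
       one = (\<lambda>X \<in> obj C. \<one>\<^bsub>Mor D (fob F X) (fob G X)\<^esub>)\<rparr>),
     ident = (\<lambda>F. \<lambda>X \<in> obj C. ident D (fob F X)),
     cmp = (\<lambda>F G H \<theta> \<eta>. \<lambda>X \<in> obj C. cmp D (fob F X) (fob G X) (fob H X) (\<theta> X) (\<eta> X))\<rparr>"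


section \<open>Finitely presented functors\<close>

text \<open>
  The abelian groups whose carrier is a set of elements of the type \<open>'a\<close>.
\<close>

definition Ab :: "('a monoid, 'a \<Rightarrow> 'a) acat" where
  "Ab = \<lparr>obj = {G. comm_group G},
     Mor = (\<lambda>G H. \<lparr>carrier = hom G H \<inter> extensional (carrier G),
       mult = (\<lambda>h k. \<lambda>x \<in> carrier G. h x \<otimes>\<^bsub>H\<^esub> k x),
       one = (\<lambda>x \<in> carrier G. \<one>\<^bsub>H\<^esub>)\<rparr>),
     ident = (\<lambda>G. \<lambda>x \<in> carrier G. x),
     cmp = (\<lambda>G H K g f. compose (carrier G) g f)\<rparr>"

text \<open>
  Contravariant functors on \<open>C\<close> are functors on \<^term>\<open>op_cat C\<close>, so \<open>fmor F X Y f\<close> is the map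
  \<open>F X \<rightarrow> F Y\<close> induced by \<open>f : Y \<rightarrow> X\<close> in \<open>C\<close>.

  Their values are groups carried by the type \<open>'m\<close> of morphisms of \<open>C\<close>, which thereby plays the
  role of the universe with respect to which \<open>C\<close> is locally small. It contains the values of
  the representable functors, and since a finitely presented \<open>F\<close> has \<open>F X\<close> a quotient of a
  hom-group, every finitely presented functor is isomorphic to one with values in this \<^const>\<open>Ab\<close>.
  A larger universe is obtained by enlarging \<open>'m\<close>.
\<close>

type_synonym ('o, 'm) presheaf = "('o, 'm, 'm monoid, 'm \<Rightarrow> 'm) functr"

definition representable :: "('o, 'm, 'x) acat_scheme \<Rightarrow> 'o \<Rightarrow> ('o, 'm) presheaf" where
  "representable C U = \<lparr>fob = (\<lambda>X. Mor C X U),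
     fmor = (\<lambda>X Y f. \<lambda>g \<in> arr C X U. cmp C Y X U g f)\<rparr>"

definition finitely_presented :: "('o, 'm, 'x) acat_scheme \<Rightarrow> ('o, 'm) presheaf \<Rightarrow> bool" where
  "finitely_presented C F \<longleftrightarrow> additive_functor (op_cat C) Ab F \<and>
     (\<exists>U1 \<in> obj C. \<exists>U0 \<in> obj C.
        \<exists>\<alpha> \<in> nat_trans (op_cat C) Ab (representable C U1) (representable C U0).
        \<exists>\<pi> \<in> nat_trans (op_cat C) Ab (representable C U0) F.
        \<forall>X \<in> obj C.
          \<alpha> X ` arr C X U1 = kernel (Mor C X U0) (fob F X) (\<pi> X) \<and>
          \<pi> X ` arr C X U0 = carrier (fob F X))"

definition mod_cat ::
    "('o, 'm, 'x) acat_scheme \<Rightarrow> (('o, 'm) presheaf, 'o \<Rightarrow> 'm \<Rightarrow> 'm) acat" where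
  "mod_cat C = full_subcat (functor_cat (op_cat C) Ab) {F. finitely_presented C F}"


section \<open>Triangulated categories\<close>

record ('o, 'm) tcat = "('o, 'm) acat" +
  shift :: "('o, 'm, 'o, 'm) functr"
  tri :: "'o \<Rightarrow> 'o \<Rightarrow> 'o \<Rightarrow> 'm \<Rightarrow> 'm \<Rightarrow> 'm \<Rightarrow> bool"

abbreviation sh :: "('o, 'm, 'x) tcat_scheme \<Rightarrow> 'o \<Rightarrow> 'o" where
  "sh T X \<equiv> fob (shift T) X"

abbreviation sh_mor :: "('o, 'm, 'x) tcat_scheme \<Rightarrow> 'o \<Rightarrow> 'o \<Rightarrow> 'm \<Rightarrow> 'm" where
  "sh_mor T X Y f \<equiv> fmor (shift T) X Y f"

text \<open>
  \<open>tri T X Y Z f g h\<close> says that \<open>X \<rightarrow> Y \<rightarrow> Z \<rightarrow> X[1]\<close>, with maps \<open>f\<close>, \<open>g\<close>, \<open>h\<close>, is a distinguished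
  triangle. The translation is only required to be an autoequivalence, which includes the case of
  an automorphism.
\<close>

locale triangulated_category = additive_category T
  for T :: "('o, 'm, 'x) tcat_scheme" +
  assumes shift_equivalence: "is_equivalence T T (shift T)"
    and tri_closed:
      "tri T X Y Z f g h \<Longrightarrow> X \<in> obj T \<and> Y \<in> obj T \<and> Z \<in> obj T \<and>
         f \<in> arr T X Y \<and> g \<in> arr T Y Z \<and> h \<in> arr T Z (sh T X)"
    and tri_iso:
      "\<lbrakk>tri T X Y Z f g h; X' \<in> obj T; Y' \<in> obj T; Z' \<in> obj T;
        f' \<in> arr T X' Y'; g' \<in> arr T Y' Z'; h' \<in> arr T Z' (sh T X');
        is_iso T X X' a; is_iso T Y Y' b; is_iso T Z Z' c;
        cmp T X Y Y' b f = cmp T X X' Y' f' a;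
        cmp T Y Z Z' c g = cmp T Y Y' Z' g' b;
        cmp T Z (sh T X) (sh T X') (sh_mor T X X' a) h = cmp T Z Z' (sh T X') h' c\<rbrakk>
        \<Longrightarrow> tri T X' Y' Z' f' g' h'"
    and tri_ident:
      "\<lbrakk>X \<in> obj T; is_zero_object T Z\<rbrakk>
        \<Longrightarrow> tri T X X Z (ident T X) \<one>\<^bsub>Mor T X Z\<^esub> \<one>\<^bsub>Mor T Z (sh T X)\<^esub>"
    and tri_complete:
      "\<lbrakk>X \<in> obj T; Y \<in> obj T; f \<in> arr T X Y\<rbrakk> \<Longrightarrow> \<exists>Z g h. tri T X Y Z f g h"
    and tri_rotate:
      "\<lbrakk>X \<in> obj T; Y \<in> obj T; Z \<in> obj T;
        f \<in> arr T X Y; g \<in> arr T Y Z; h \<in> arr T Z (sh T X)\<rbrakk>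
        \<Longrightarrow> tri T X Y Z f g h \<longleftrightarrow>
            tri T Y Z (sh T X) g h (inv\<^bsub>Mor T (sh T X) (sh T Y)\<^esub> sh_mor T X Y f)"
    and tri_morphism:
      "\<lbrakk>tri T X Y Z f g h; tri T X' Y' Z' f' g' h'; a \<in> arr T X X'; b \<in> arr T Y Y';
        cmp T X Y Y' b f = cmp T X X' Y' f' a\<rbrakk>
        \<Longrightarrow> \<exists>c \<in> arr T Z Z'.
              cmp T Y Z Z' c g = cmp T Y Y' Z' g' b \<and>
              cmp T Z (sh T X) (sh T X') (sh_mor T X X' a) h = cmp T Z Z' (sh T X') h' c"
    and octahedral:
      "\<lbrakk>tri T X Y A f f1 f2; tri T Y Z B g g1 g2; tri T X Z E (cmp T X Y Z g f) h1 h2\<rbrakk>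
        \<Longrightarrow> \<exists>u \<in> arr T A E. \<exists>v \<in> arr T E B.
              tri T A E B u v (cmp T B (sh T Y) (sh T A) (sh_mor T Y A f1) g2) \<and>
              cmp T Y A E u f1 = cmp T Y Z E h1 g \<and>
              cmp T A E (sh T X) h2 u = f2 \<and>
              cmp T Z E B v h1 = g1 \<and>
              cmp T E B (sh T Y) g2 v = cmp T E (sh T X) (sh T Y) (sh_mor T X Y f) h2"

definition shift_class :: "('o, 'm, 'x) tcat_scheme \<Rightarrow> 'o set \<Rightarrow> 'o set" where
  "shift_class T A = {X \<in> obj T. \<exists>Y \<in> A. isomorphic T X (sh T Y)}"

definition unshift_class :: "('o, 'm, 'x) tcat_scheme \<Rightarrow> 'o set \<Rightarrow> 'o set" where
  "unshift_class T A = {X \<in> obj T. \<exists>Y \<in> A. isomorphic T (sh T X) Y}"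

definition star :: "('o, 'm, 'x) tcat_scheme \<Rightarrow> 'o set \<Rightarrow> 'o set \<Rightarrow> 'o set" where
  "star T \<A> \<B> = {X. \<exists>A \<in> \<A>. \<exists>B \<in> \<B>. \<exists>f g h. tri T A X B f g h}"


section \<open>Cotorsion pairs, hearts and left exact functors\<close>

definition cotorsion_pair :: "('o, 'm, 'x) tcat_scheme \<Rightarrow> 'o set \<Rightarrow> 'o set \<Rightarrow> bool" where
  "cotorsion_pair T \<U> \<V> \<longleftrightarrow>
     additive_subclass T \<U> \<and> additive_subclass T \<V> \<and>
     closed_under_summands T \<U> \<and> closed_under_summands T \<V> \<and>
     (\<forall>U \<in> \<U>. \<forall>V \<in> \<V>. arr T U (sh T V) = {\<one>\<^bsub>Mor T U (sh T V)\<^esub>}) \<and>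
     (\<forall>X \<in> obj T. \<exists>U \<in> \<U>. \<exists>V \<in> \<V>. \<exists>f g h. tri T U X (sh T V) f g h)"

definition T_plus :: "('o, 'm, 'x) tcat_scheme \<Rightarrow> 'o set \<Rightarrow> 'o set \<Rightarrow> 'o set" where
  "T_plus T \<U> \<V> = star T (\<U> \<inter> \<V>) (shift_class T \<V>)"

definition T_minus :: "('o, 'm, 'x) tcat_scheme \<Rightarrow> 'o set \<Rightarrow> 'o set \<Rightarrow> 'o set" where
  "T_minus T \<U> \<V> = star T (unshift_class T \<U>) (\<U> \<inter> \<V>)"

definition heart :: "('o, 'm, 'x) tcat_scheme \<Rightarrow> 'o set \<Rightarrow> 'o set \<Rightarrow> ('o, 'm set) acat" where
  "heart T \<U> \<V> =
     quotient_cat (full_subcat T (T_plus T \<U> \<V> \<inter> T_minus T \<U> \<V>)) (\<U> \<inter> \<V>)"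

definition conflation ::
    "('o, 'm, 'x) tcat_scheme \<Rightarrow> 'o set \<Rightarrow> 'o \<Rightarrow> 'o \<Rightarrow> 'o \<Rightarrow> 'm \<Rightarrow> 'm \<Rightarrow> bool" where
  "conflation T \<U> Z Y X i p \<longleftrightarrow>
     Z \<in> \<U> \<and> Y \<in> \<U> \<and> X \<in> \<U> \<and> (\<exists>h. tri T Z Y X i p h)"

definition left_exact :: "('o, 'm, 'x) tcat_scheme \<Rightarrow> 'o set \<Rightarrow> ('o, 'm) presheaf \<Rightarrow> bool" where
  "left_exact T \<U> F \<longleftrightarrow>
     (\<forall>Z Y X i p. conflation T \<U> Z Y X i p \<longrightarrow>
        inj_on (fmor F X Y p) (carrier (fob F X)) \<and>
        fmor F X Y p ` carrier (fob F X) = kernel (fob F Y) (fob F Z) (fmor F Y Z i))"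

definition lex_cat ::
    "('o, 'm, 'x) tcat_scheme \<Rightarrow> 'o set \<Rightarrow> (('o, 'm) presheaf, 'o \<Rightarrow> 'm \<Rightarrow> 'm) acat" where
  "lex_cat T \<U> = full_subcat (mod_cat (full_subcat T \<U>))
     {F \<in> obj (mod_cat (full_subcat T \<U>)). left_exact T \<U> F}"

end

theory Submission
  imports Defs
begin

text \<open>
  The equivalence is induced by \<open>H \<mapsto> \<T>(-, H[1])\<close>, restricted to \<open>\<U>\<close>. Write \<open>G\<^sub>H\<close> for this functor
  and \<open>\<W> = \<U> \<inter> \<V>\<close>. Each half of the definition of the heart accounts for one property of \<open>G\<^sub>H\<close>.

  If \<open>H \<in> \<T>\<^sup>-\<close>, there is a triangle \<open>H \<rightarrow> W \<rightarrow> U \<rightarrow> H[1]\<close> with \<open>W \<in> \<W>\<close> and \<open>U \<in> \<U>\<close>. As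
  \<open>\<T>(\<U>, W[1]) = 0\<close>, every map from \<open>\<U>\<close> to \<open>H[1]\<close> lifts to \<open>U\<close>, so \<open>W \<rightarrow> U\<close> is a presentation of \<open>G\<^sub>H\<close>
  (\<open>finitely_presented_of_T_minus\<close>). A transformation \<open>G\<^sub>H \<rightarrow> G\<^sub>H\<^sub>'\<close> is determined by the image of the
  generator \<open>U \<rightarrow> H[1]\<close>, which dies on \<open>W\<close> and therefore extends to a morphism \<open>H[1] \<rightarrow> H'[1]\<close>
  (\<open>post_comp_full\<close>); it vanishes iff this morphism kills the generator, that is iff it factors through
  \<open>W[1]\<close> (\<open>post_comp_zero_iff\<close>). So the functor is full and its kernel is exactly the ideal \<open>[\<W>]\<close>.

  If \<open>H \<in> \<T>\<^sup>+\<close>, every map from \<open>\<U>\<close> to \<open>H\<close> factors through \<open>\<W>\<close>. For a conflation \<open>Z \<rightarrow> Y \<rightarrow> X\<close> this makes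
  the connecting map \<open>\<T>(Z[1], H[1]) \<rightarrow> \<T>(X, H[1])\<close> zero, whence \<open>G\<^sub>H\<close> is left exact
  (\<open>left_exact_of_T_plus\<close>).

  It remains to realise a left exact \<open>F\<close> with presentation \<open>U\<^sub>1 \<rightarrow> U\<^sub>0 \<rightarrow> F\<close> (\<open>essentially_surjective\<close>).
  The fibre \<open>X\<close> of \<open>U\<^sub>1 \<rightarrow> U\<^sub>0\<close> need not lie in \<open>\<T>\<^sup>+\<close>. It is corrected to a cone \<open>H\<close> of a map \<open>Z \<rightarrow> X\<close>
  with \<open>Z[1] \<in> \<U>\<close>, and the octahedral axiom provides triangles \<open>W \<rightarrow> H \<rightarrow> V[1]\<close> and \<open>H \<rightarrow> B \<rightarrow> U\<^sub>0\<close>, where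
  \<open>B\<close> is an extension of \<open>Z[1]\<close> by \<open>U\<^sub>1\<close>; so \<open>H\<close> is in the heart. Left exactness of \<open>F\<close> shows that enlarging
  \<open>U\<^sub>1\<close> to \<open>B\<close> adds no relations, and left exactness of both \<open>F\<close> and \<open>G\<^sub>H\<close> shows that \<open>U\<^sub>0 \<rightarrow> G\<^sub>H\<close> is an
  epimorphism. Hence \<open>F\<close> and \<open>G\<^sub>H\<close> are the same quotient of \<open>\<U>(-, U\<^sub>0)\<close>.

  The passage from such a functor to an equivalence on the quotient category is the first isomorphism
  theorem for additive categories (\<open>quotient_equivalence\<close>).
\<close>

section \<open>Preadditive structures on functor categories\<close>

context preadditive_category
begin

lemma group_Mor: "\<lbrakk>X \<in> obj C; Y \<in> obj C\<rbrakk> \<Longrightarrow> group (Mor C X Y)"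
  by (simp add: Mor_comm_group comm_group.axioms(2))

lemma zero_closed: "\<lbrakk>X \<in> obj C; Y \<in> obj C\<rbrakk> \<Longrightarrow> \<one>\<^bsub>Mor C X Y\<^esub> \<in> arr C X Y"
  by (simp add: group.is_monoid group_Mor monoid.one_closed)

lemma add_closed:
  "\<lbrakk>X \<in> obj C; Y \<in> obj C; f \<in> arr C X Y; g \<in> arr C X Y\<rbrakk> \<Longrightarrow> f \<otimes>\<^bsub>Mor C X Y\<^esub> g \<in> arr C X Y"
  by (simp add: group.is_monoid group_Mor monoid.m_closed)

lemma neg_closed:
  "\<lbrakk>X \<in> obj C; Y \<in> obj C; f \<in> arr C X Y\<rbrakk> \<Longrightarrow> inv\<^bsub>Mor C X Y\<^esub> f \<in> arr C X Y"
  by (simp add: group.inv_closed group_Mor)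

lemma cmp_hom_left:
  assumes "X \<in> obj C" "Y \<in> obj C" "Z \<in> obj C" "f \<in> arr C X Y"
  shows "group_hom (Mor C Y Z) (Mor C X Z) (\<lambda>g. cmp C X Y Z g f)"
  using assms by (simp add: group_hom_def group_hom_axioms_def hom_def group_Mor cmp_closed cmp_add_left Pi_def)

lemma cmp_hom_right:
  assumes "X \<in> obj C" "Y \<in> obj C" "Z \<in> obj C" "g \<in> arr C Y Z"
  shows "group_hom (Mor C X Y) (Mor C X Z) (cmp C X Y Z g)"
  using assms by (simp add: group_hom_def group_hom_axioms_def hom_def group_Mor cmp_closed
      cmp_add_right Pi_def)

lemma cmp_zero_left:
  "\<lbrakk>X \<in> obj C; Y \<in> obj C; Z \<in> obj C; f \<in> arr C X Y\<rbrakk> \<Longrightarrow> cmp C X Y Z \<one>\<^bsub>Mor C Y Z\<^esub> f = \<one>\<^bsub>Mor C X Z\<^esub>"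
  using group_hom.hom_one[OF cmp_hom_left] .

lemma cmp_zero_right:
  "\<lbrakk>X \<in> obj C; Y \<in> obj C; Z \<in> obj C; g \<in> arr C Y Z\<rbrakk> \<Longrightarrow> cmp C X Y Z g \<one>\<^bsub>Mor C X Y\<^esub> = \<one>\<^bsub>Mor C X Z\<^esub>"
  using group_hom.hom_one[OF cmp_hom_right] .

lemma cmp_neg_left:
  "\<lbrakk>X \<in> obj C; Y \<in> obj C; Z \<in> obj C; f \<in> arr C X Y; g \<in> arr C Y Z\<rbrakk>
   \<Longrightarrow> cmp C X Y Z (inv\<^bsub>Mor C Y Z\<^esub> g) f = inv\<^bsub>Mor C X Z\<^esub> cmp C X Y Z g f"
  using group_hom.hom_inv[OF cmp_hom_left] .

lemma cmp_neg_right: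
  "\<lbrakk>X \<in> obj C; Y \<in> obj C; Z \<in> obj C; f \<in> arr C X Y; g \<in> arr C Y Z\<rbrakk>
   \<Longrightarrow> cmp C X Y Z g (inv\<^bsub>Mor C X Y\<^esub> f) = inv\<^bsub>Mor C X Z\<^esub> cmp C X Y Z g f"
  using group_hom.hom_inv[OF cmp_hom_right] .

lemma is_iso_ident: "X \<in> obj C \<Longrightarrow> is_iso C X X (ident C X)"
  unfolding is_iso_def by (blast intro: ident_closed cmp_ident_left)

lemma isomorphic_refl: "X \<in> obj C \<Longrightarrow> isomorphic C X X"
  unfolding isomorphic_def using is_iso_ident by blast

lemma isomorphic_sym: "isomorphic C X Y \<Longrightarrow> isomorphic C Y X"
  unfolding isomorphic_def is_iso_def by blast

lemma full_subcat_preadditive: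
  assumes "A \<subseteq> obj C"
  shows "preadditive_category (full_subcat C A)"
  unfolding full_subcat_def
  by (rule preadditive_category.intro)
    (use assms in \<open>auto simp: Mor_comm_group ident_closed cmp_closed cmp_ident_left cmp_ident_right
      cmp_assoc cmp_add_left cmp_add_right subset_iff\<close>)

end

lemma Ab_preadditive: "preadditive_category (Ab :: ('a monoid, 'a \<Rightarrow> 'a) acat)"
proof (rule preadditive_category.intro)
  show "comm_group (Mor Ab G H)" if "G \<in> obj Ab" "H \<in> obj Ab" for G H :: "'a monoid"
  proof -
    interpret G: comm_group G using that by (simp add: Ab_def)
    interpret H: comm_group H using that by (simp add: Ab_def)
    show ?thesis
    proof (rule comm_groupI)
      show "\<exists>y\<in>arr Ab G H. y \<otimes>\<^bsub>Mor Ab G H\<^esub> x = \<one>\<^bsub>Mor Ab G H\<^esub>" if "x \<in> arr Ab G H" for x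
        by (rule bexI[where x = "\<lambda>z\<in>carrier G. inv\<^bsub>H\<^esub> x z"])
          (use that in \<open>auto simp: Ab_def hom_def Pi_iff H.inv_mult intro!: restrict_ext\<close>)
    qed (auto simp: Ab_def hom_def Pi_iff H.m_ac extensional_def intro!: ext)
  qed
qed (auto simp: Ab_def hom_def Pi_iff compose_def extensional_def comm_group_def comm_monoid_def monoid.m_closed
  intro!: ext monoid.one_closed)

lemma functor_cat_preadditive:
  assumes "preadditive_category D"
  shows "preadditive_category (functor_cat C D)"
proof -
  interpret D: preadditive_category D by fact
  note [simp] = D.cmp_closed D.add_closed D.zero_closed D.neg_closed D.cmp_add_left
      D.cmp_add_right D.cmp_zero_left D.cmp_zero_right
    D.cmp_neg_left D.cmp_neg_right D.ident_closed D.cmp_ident_left D.cmp_ident_right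
  show ?thesis
  proof (rule preadditive_category.intro)
    show "comm_group (Mor (functor_cat C D) F G)"
      if "F \<in> obj (functor_cat C D)" "G \<in> obj (functor_cat C D)" for F G
    proof -
      have F: "fob F X \<in> obj D" "fob G X \<in> obj D" if "X \<in> obj C" for X
        using that \<open>F \<in> _\<close> \<open>G \<in> _\<close> by (auto simp: functor_cat_def additive_functor_def)
      have Fm: "fmor F X Y f \<in> arr D (fob F X) (fob F Y)" "fmor G X Y f \<in> arr D (fob G X) (fob G Y)"
        if "X \<in> obj C" "Y \<in> obj C" "f \<in> arr C X Y" for X Y f
        using that \<open>F \<in> _\<close> \<open>G \<in> _\<close> by (auto simp: functor_cat_def additive_functor_def hom_def Pi_iff)
      have grp: "comm_group (Mor D (fob F X) (fob G X))" if "X \<in> obj C" for X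
        using F that D.Mor_comm_group by blast
      note [simp] = F Fm
      show ?thesis
      proof (rule comm_groupI)
        show "\<exists>y\<in>arr (functor_cat C D) F G. y \<otimes>\<^bsub>Mor (functor_cat C D) F G\<^esub> x = \<one>\<^bsub>Mor (functor_cat C D) F G\<^esub>"
          if "x \<in> arr (functor_cat C D) F G" for x
          by (rule bexI[where x = "\<lambda>X\<in>obj C. inv\<^bsub>Mor D (fob F X) (fob G X)\<^esub> x X"])
            (use that in \<open>auto simp: functor_cat_def nat_trans_def PiE_iff D.group_Mor group.l_inv
                intro!: restrict_ext\<close>)
      next
        fix x y z
        assume "x \<in> arr (functor_cat C D) F G" "y \<in> arr (functor_cat C D) F G" "z \<in> arr (functor_cat C D) F G"
        then show "x \<otimes>\<^bsub>Mor (functor_cat C D) F G\<^esub> y \<otimes>\<^bsub>Mor (functor_cat C D) F G\<^esub> z =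
          x \<otimes>\<^bsub>Mor (functor_cat C D) F G\<^esub> (y \<otimes>\<^bsub>Mor (functor_cat C D) F G\<^esub> z)"
          by (auto simp: functor_cat_def nat_trans_def PiE_iff D.group_Mor group.is_monoid
              monoid.m_assoc intro!: restrict_ext)
      next
        fix x y
        assume "x \<in> arr (functor_cat C D) F G" "y \<in> arr (functor_cat C D) F G"
        then show "x \<otimes>\<^bsub>Mor (functor_cat C D) F G\<^esub> y = y \<otimes>\<^bsub>Mor (functor_cat C D) F G\<^esub> x"
          using grp by (auto simp: functor_cat_def nat_trans_def PiE_iff comm_group_def
              comm_monoid.m_comm intro!: restrict_ext)
      next
        fix x
        assume "x \<in> arr (functor_cat C D) F G"
        then show "\<one>\<^bsub>Mor (functor_cat C D) F G\<^esub> \<otimes>\<^bsub>Mor (functor_cat C D) F G\<^esub> x = x"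
          by (auto simp: functor_cat_def nat_trans_def PiE_iff D.group_Mor group.is_monoid
              monoid.l_one extensional_def intro!: ext)
      qed (auto simp: functor_cat_def nat_trans_def PiE_iff)
    qed
  next
    fix F G H \<eta> \<theta>
    assume "F \<in> obj (functor_cat C D)" "G \<in> obj (functor_cat C D)" "H \<in> obj (functor_cat C D)"
      and "\<eta> \<in> arr (functor_cat C D) F G" "\<theta> \<in> arr (functor_cat C D) G H"
    then show "cmp (functor_cat C D) F G H \<theta> \<eta> \<in> arr (functor_cat C D) F H"
      apply (auto simp: functor_cat_def nat_trans_def PiE_iff additive_functor_def hom_def Pi_iff)
      by (smt (verit, ccfv_SIG) D.cmp_assoc)
  qed (auto simp: functor_cat_def nat_trans_def PiE_iff additive_functor_def hom_def Pi_iff D.cmp_assoc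
       extensional_def intro!: ext restrict_ext)
qed

section \<open>Equivalences and quotients by ideals\<close>

context preadditive_category
begin

lemma iso_cancel_left:
  assumes "is_iso C Y Z e" "cmp C X Y Z e f = cmp C X Y Z e f'"
    and "X \<in> obj C" "Y \<in> obj C" "Z \<in> obj C" "f \<in> arr C X Y" "f' \<in> arr C X Y"
  shows "f = f'"
proof -
  obtain e' where "e' \<in> arr C Z Y" "cmp C Y Z Y e' e = ident C Y" and "e \<in> arr C Y Z"
    using assms(1) by (auto simp: is_iso_def)
  then have "cmp C X Z Y e' (cmp C X Y Z e k) = k" if "k \<in> arr C X Y" for k
    using that assms(3-5) by (simp add: cmp_assoc cmp_ident_left)
  then show ?thesis
    using assms(2,6,7) by metis
qed

lemma iso_cancel_right:
  assumes "is_iso C X Y e" "cmp C X Y Z f e = cmp C X Y Z f' e"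
    and "X \<in> obj C" "Y \<in> obj C" "Z \<in> obj C" "f \<in> arr C Y Z" "f' \<in> arr C Y Z"
  shows "f = f'"
proof -
  obtain e' where "e' \<in> arr C Y X" "cmp C Y X Y e e' = ident C Y" and "e \<in> arr C X Y"
    using assms(1) by (auto simp: is_iso_def)
  then have "cmp C Y X Z (cmp C X Y Z k e) e' = k" if "k \<in> arr C Y Z" for k
    using that assms(3-5) by (simp add: cmp_assoc[symmetric] cmp_ident_right)
  then show ?thesis
    using assms(2,6,7) by metis
qed

end

lemma additive_functorD:
  assumes "additive_functor C D F" "X \<in> obj C"
  shows "fob F X \<in> obj D"
    and "fmor F X X (ident C X) = ident D (fob F X)"
    and "Y \<in> obj C \<Longrightarrow> fmor F X Y \<in> hom (Mor C X Y) (Mor D (fob F X) (fob F Y))"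
    and "\<lbrakk>Y \<in> obj C; f \<in> arr C X Y\<rbrakk> \<Longrightarrow> fmor F X Y f \<in> arr D (fob F X) (fob F Y)"
    and "\<lbrakk>Y \<in> obj C; Z \<in> obj C; f \<in> arr C X Y; g \<in> arr C Y Z\<rbrakk> \<Longrightarrow> fmor F X Z (cmp C X Y Z g f)
          = cmp D (fob F X) (fob F Y) (fob F Z) (fmor F Y Z g) (fmor F X Y f)"
  using assms by (auto simp: additive_functor_def hom_def)

text \<open>
  A natural isomorphism \<open>1 \<cong> G F\<close> intertwines \<open>f\<close> with \<open>G (F f)\<close>, so \<open>f\<close> can be recovered from \<open>F f\<close>.
\<close>

lemma faithful_of_unit:
  assumes "preadditive_category C" "additive_functor C D F" "additive_functor D C G"
    and "naturally_isomorphic C C id_functor (comp_functor G F)"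
    and "X \<in> obj C" "Y \<in> obj C"
  shows "inj_on (fmor F X Y) (arr C X Y)"
proof (rule inj_onI)
  interpret C: preadditive_category C by fact
  fix f f' assume f: "f \<in> arr C X Y" "f' \<in> arr C X Y" "fmor F X Y f = fmor F X Y f'"
  obtain \<eta> where \<eta>: "\<eta> \<in> nat_trans C C id_functor (comp_functor G F)"
      "\<And>X. X \<in> obj C \<Longrightarrow> is_iso C X (fob G (fob F X)) (\<eta> X)"
    using assms(4) by (auto simp: naturally_isomorphic_def id_functor_def comp_functor_def)
  have "cmp C X Y (fob G (fob F Y)) (\<eta> Y) f = cmp C X Y (fob G (fob F Y)) (\<eta> Y) f'"
    using \<eta>(1) f assms(5,6) by (auto simp: nat_trans_def id_functor_def comp_functor_def)
  then show "f = f'"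
    by (rule C.iso_cancel_left[OF \<eta>(2)[OF assms(6)] _ assms(5,6) _ f(1,2)])
      (intro additive_functorD(1)[OF assms(3)] additive_functorD(1)[OF assms(2)] assms(6))
qed

text \<open>
  The same with the isomorphism in the other direction. It serves for the quasi-inverse of an
  equivalence, whose given isomorphism \<open>F G \<cong> 1\<close> points that way.
\<close>

lemma faithful_of_counit:
  assumes "preadditive_category C" "additive_functor C D F" "additive_functor D C G"
    and "naturally_isomorphic C C (comp_functor G F) id_functor"
    and "X \<in> obj C" "Y \<in> obj C"
  shows "inj_on (fmor F X Y) (arr C X Y)"
proof (rule inj_onI)
  interpret C: preadditive_category C by fact
  fix f f' assume f: "f \<in> arr C X Y" "f' \<in> arr C X Y" "fmor F X Y f = fmor F X Y f'"
  obtain \<eta> where \<eta>: "\<eta> \<in> nat_trans C C (comp_functor G F) id_functor"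
      "\<And>X. X \<in> obj C \<Longrightarrow> is_iso C (fob G (fob F X)) X (\<eta> X)"
    using assms(4) by (auto simp: naturally_isomorphic_def id_functor_def comp_functor_def)
  have "cmp C (fob G (fob F X)) X Y k (\<eta> X)
      = cmp C (fob G (fob F X)) (fob G (fob F Y)) Y (\<eta> Y) (fmor G (fob F X) (fob F Y) (fmor F X Y k))"
    if "k \<in> arr C X Y" for k
    using \<eta>(1) that assms(5,6) by (auto simp: nat_trans_def id_functor_def comp_functor_def)
  then have "cmp C (fob G (fob F X)) X Y f (\<eta> X) = cmp C (fob G (fob F X)) X Y f' (\<eta> X)"
    using f by simp
  then show "f = f'"
    by (rule C.iso_cancel_right[OF \<eta>(2)[OF assms(5)] _ _ assms(5,6) f(1,2)])
      (intro additive_functorD(1)[OF assms(3)] additive_functorD(1)[OF assms(2)] assms(5))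
qed

lemma equivalence_faithful:
  assumes "preadditive_category C" "is_equivalence C D F" "X \<in> obj C" "Y \<in> obj C"
  shows "inj_on (fmor F X Y) (arr C X Y)"
proof -
  obtain G where "additive_functor C D F" "additive_functor D C G"
      "naturally_isomorphic C C id_functor (comp_functor G F)"
    using assms(2) by (auto simp: is_equivalence_def)
  then show ?thesis by (rule faithful_of_unit[OF assms(1) _ _ _ assms(3,4)])
qed

text \<open>
  Conjugating \<open>G g\<close> by the unit gives \<open>f\<close> with \<open>G (F f) = G g\<close>, and \<open>G\<close> is faithful.
\<close>

lemma equivalence_full:
  assumes "preadditive_category C" "preadditive_category D" "is_equivalence C D F"
    and X: "X \<in> obj C" and Y: "Y \<in> obj C" and g: "g \<in> arr D (fob F X) (fob F Y)"
  shows "\<exists>f \<in> arr C X Y. fmor F X Y f = g"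
proof -
  interpret C: preadditive_category C by fact
  interpret D: preadditive_category D by fact
  obtain G \<eta> where F: "additive_functor C D F" and G: "additive_functor D C G"
    and \<eta>: "\<eta> \<in> nat_trans C C id_functor (comp_functor G F)"
      "\<And>X. X \<in> obj C \<Longrightarrow> is_iso C X (fob G (fob F X)) (\<eta> X)"
    and FG: "naturally_isomorphic D D (comp_functor F G) id_functor"
    using assms(3) by (auto simp: is_equivalence_def naturally_isomorphic_def id_functor_def comp_functor_def)
  let ?GX = "fob G (fob F X)" and ?GY = "fob G (fob F Y)" and ?h = "fmor G (fob F X) (fob F Y) g"
  note FX = additive_functorD(1)[OF F X] and FY = additive_functorD(1)[OF F Y]
  have GX: "?GX \<in> obj C" "?GY \<in> obj C" and h: "?h \<in> arr C ?GX ?GY"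
    using additive_functorD(1,4)[OF G] FX FY g by auto
  obtain e where e: "e \<in> arr C ?GY Y" "cmp C ?GY Y ?GY (\<eta> Y) e = ident C ?GY"
    using \<eta>(2)[OF Y] by (auto simp: is_iso_def)
  have a: "\<eta> X \<in> arr C X ?GX" "\<eta> Y \<in> arr C Y ?GY" using \<eta>(2) X Y by (auto simp: is_iso_def)
  define f where "f = cmp C X ?GY Y e (cmp C X ?GX ?GY ?h (\<eta> X))"
  have f: "f \<in> arr C X Y" unfolding f_def by (intro C.cmp_closed X Y GX h e a)
  have "cmp C X ?GX ?GY (fmor G (fob F X) (fob F Y) (fmor F X Y f)) (\<eta> X) = cmp C X Y ?GY (\<eta> Y) f"
    using \<eta>(1) X Y f by (auto simp: nat_trans_def id_functor_def comp_functor_def)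
  also have "\<dots> = cmp C X ?GX ?GY ?h (\<eta> X)"
    unfolding f_def using X Y GX h e a by (simp add: C.cmp_assoc C.cmp_closed C.cmp_ident_left)
  finally have "fmor G (fob F X) (fob F Y) (fmor F X Y f) = ?h"
    by (rule C.iso_cancel_right[OF \<eta>(2)[OF X] _ X GX _ h])
      (rule additive_functorD(4)[OF G FX FY additive_functorD(4)[OF F X Y f]])
  moreover have "inj_on (fmor G (fob F X) (fob F Y)) (arr D (fob F X) (fob F Y))"
    using faithful_of_counit[OF assms(2) G F FG FX FY] .
  ultimately show ?thesis
    using f g additive_functorD(4)[OF F X Y f] by (auto dest: inj_onD)
qed

lemma equivalence_essentially_surjective:
  assumes "is_equivalence C D F" "Y \<in> obj D"
  shows "\<exists>X \<in> obj C. isomorphic D (fob F X) Y"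
proof -
  obtain G where G: "additive_functor D C G" and FG: "naturally_isomorphic D D (comp_functor F G) id_functor"
    using assms(1) by (auto simp: is_equivalence_def)
  obtain \<eta> where "is_iso D (fob F (fob G Y)) Y (\<eta> Y)"
    using FG assms(2) by (auto simp: naturally_isomorphic_def id_functor_def comp_functor_def)
  then show ?thesis
    using additive_functorD(1)[OF G assms(2)] unfolding isomorphic_def by blast
qed

text \<open>
  A quasi-inverse is chosen object by object, together with isomorphisms \<open>e Y : F (g Y) \<rightarrow> Y\<close>, and a
  morphism \<open>k\<close> goes to the unique preimage of \<open>e\<^sup>-\<^sup>1 k e\<close>. Every law on the source side is verified
  after applying the bijections \<open>F\<close>; hence \<open>C\<close> only has to be closed under its operations, and its
  category axioms are inherited from \<open>D\<close>. For quotient categories this saves a direct verification.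
\<close>

lemma equivalenceI:
  assumes "preadditive_category D"
    and grp: "\<And>X Y. \<lbrakk>X \<in> obj C; Y \<in> obj C\<rbrakk> \<Longrightarrow> group (Mor C X Y)"
    and ident: "\<And>X. X \<in> obj C \<Longrightarrow> ident C X \<in> arr C X X"
    and comp: "\<And>X Y Z f g. \<lbrakk>X \<in> obj C; Y \<in> obj C; Z \<in> obj C; f \<in> arr C X Y; g \<in> arr C Y Z\<rbrakk>
        \<Longrightarrow> cmp C X Y Z g f \<in> arr C X Z"
    and F: "additive_functor C D F"
    and ff: "\<And>X Y. \<lbrakk>X \<in> obj C; Y \<in> obj C\<rbrakk>
        \<Longrightarrow> bij_betw (fmor F X Y) (arr C X Y) (arr D (fob F X) (fob F Y))"
    and ess: "\<And>Y. Y \<in> obj D \<Longrightarrow> \<exists>X \<in> obj C. isomorphic D (fob F X) Y"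
  shows "is_equivalence C D F"
proof -
  interpret D: preadditive_category D by fact
  note [simp] = additive_functorD(1,2)[OF F]
  have "\<forall>Y. \<exists>X e e'. Y \<in> obj D \<longrightarrow> X \<in> obj C \<and> e \<in> arr D (fob F X) Y \<and> e' \<in> arr D Y (fob F X) \<and>
     cmp D (fob F X) Y (fob F X) e' e = ident D (fob F X) \<and> cmp D Y (fob F X) Y e e' = ident D Y"
    using ess unfolding isomorphic_def is_iso_def by metis
  then obtain g e e' where g[simp]: "\<And>Y. Y \<in> obj D \<Longrightarrow> g Y \<in> obj C"
    and e[simp]: "\<And>Y. Y \<in> obj D \<Longrightarrow> e Y \<in> arr D (fob F (g Y)) Y"
    and e'[simp]: "\<And>Y. Y \<in> obj D \<Longrightarrow> e' Y \<in> arr D Y (fob F (g Y))"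
    and e'e: "\<And>Y. Y \<in> obj D \<Longrightarrow> cmp D (fob F (g Y)) Y (fob F (g Y)) (e' Y) (e Y) = ident D (fob F (g Y))"
    and ee': "\<And>Y. Y \<in> obj D \<Longrightarrow> cmp D Y (fob F (g Y)) Y (e Y) (e' Y) = ident D Y"
    by metis
  define P where "P X Y k = inv_into (arr C X Y) (fmor F X Y) k" for X Y k
  have P[simp]: "P X Y k \<in> arr C X Y" "fmor F X Y (P X Y k) = k"
    if "X \<in> obj C" "Y \<in> obj C" "k \<in> arr D (fob F X) (fob F Y)" for X Y k
    using ff[OF that(1,2)] that(3) unfolding P_def
    by (auto simp: bij_betw_def inv_into_into f_inv_into_f)
  have inj: "f = f'" if "fmor F X Y f = fmor F X Y f'" "X \<in> obj C" "Y \<in> obj C" "f \<in> arr C X Y" "f' \<in> arr C X Y"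
    for X Y f f'
    using ff[of X Y] that by (auto simp: bij_betw_def dest: inj_onD)
  define m where "m Y Y' k = cmp D (fob F (g Y)) Y' (fob F (g Y')) (e' Y') (cmp D (fob F (g Y)) Y
      Y' k (e Y))" for Y Y' k
  have m[simp]: "m Y Y' k \<in> arr D (fob F (g Y)) (fob F (g Y'))"
    if "Y \<in> obj D" "Y' \<in> obj D" "k \<in> arr D Y Y'" for Y Y' k
    using that by (simp add: m_def D.cmp_closed)
  define G where "G = \<lparr>fob = g, fmor = (\<lambda>Y Y' k. P (g Y) (g Y') (m Y Y' k))\<rparr>"
  have G: "additive_functor D C G"
    unfolding additive_functor_def
  proof (intro conjI ballI)
    fix Y Y' assume [simp]: "Y \<in> obj D" "Y' \<in> obj D"
    have *: "P (g Y) (g Y') (m Y Y' (k \<otimes>\<^bsub>Mor D Y Y'\<^esub> l)) = P (g Y) (g Y') (m Y Y' k) \<otimes>\<^bsub>Mor C (g Y)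
        (g Y')\<^esub> P (g Y) (g Y') (m Y Y' l)"
      if [simp]: "k \<in> arr D Y Y'" "l \<in> arr D Y Y'" for k l
    proof (rule inj[of "g Y" "g Y'"])
      show "fmor F (g Y) (g Y') (P (g Y) (g Y') (m Y Y' (k \<otimes>\<^bsub>Mor D Y Y'\<^esub> l))) =
        fmor F (g Y) (g Y') (P (g Y) (g Y') (m Y Y' k) \<otimes>\<^bsub>Mor C (g Y) (g Y')\<^esub> P (g Y) (g Y') (m Y Y' l))"
        using hom_mult[OF additive_functorD(3)[OF F, of "g Y" "g Y'"]]
        by (simp add: D.add_closed) (simp add: m_def D.cmp_add_left D.cmp_add_right D.cmp_closed)
    qed (use grp[of "g Y" "g Y'"] in \<open>simp_all add: D.add_closed group.is_monoid monoid.m_closed\<close>)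
    then show "fmor G Y Y' \<in> hom (Mor D Y Y') (Mor C (fob G Y) (fob G Y'))"
      by (auto simp: G_def hom_def)
  next
    fix Y assume [simp]: "Y \<in> obj D"
    show "fmor G Y Y (ident D Y) = ident C (fob G Y)"
      unfolding G_def
      by (simp, rule inj[of "g Y" "g Y"])
        (simp_all add: D.ident_closed ident, simp add: m_def D.cmp_ident_left e'e)
  next
    fix Y1 Y2 Y3 k l assume [simp]: "Y1 \<in> obj D" "Y2 \<in> obj D" "Y3 \<in> obj D" "k \<in> arr D Y1 Y2" "l \<in> arr D Y2 Y3"
    let ?F = "\<lambda>Y. fob F (g Y)"
    have "cmp D (?F Y1) (?F Y2) (?F Y3) (m Y2 Y3 l) (m Y1 Y2 k)
        = cmp D (?F Y1) Y2 (?F Y3) (cmp D Y2 Y3 (?F Y3) (e' Y3) (cmp D Y2 Y2 Y3 l (cmp D Y2 (?F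
            Y2) Y2 (e Y2) (e' Y2)))) (cmp D (?F Y1) Y1 Y2 k (e Y1))"
      by (simp add: m_def D.cmp_assoc D.cmp_closed)
    also have "\<dots> = m Y1 Y3 (cmp D Y1 Y2 Y3 l k)"
      by (simp add: ee' D.cmp_ident_right) (simp add: m_def D.cmp_assoc D.cmp_closed)
    finally show "fmor G Y1 Y3 (cmp D Y1 Y2 Y3 l k) = cmp C (fob G Y1) (fob G Y2) (fob G Y3) (fmor
        G Y2 Y3 l) (fmor G Y1 Y2 k)"
      unfolding G_def
      by (simp, intro inj[of "g Y1" "g Y3"])
        (simp_all add: comp D.cmp_closed additive_functorD(5)[OF F])
  qed (simp add: G_def)
  have unit: "naturally_isomorphic C C id_functor (comp_functor G F)"
  proof -
    define \<eta> where "\<eta> = (\<lambda>X \<in> obj C. P X (g (fob F X)) (e' (fob F X)))"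
    have "is_iso C X (g (fob F X)) (\<eta> X)" if [simp]: "X \<in> obj C" for X
      unfolding is_iso_def
    proof (intro conjI bexI)
      let ?\<zeta> = "P (g (fob F X)) X (e (fob F X))"
      show "\<eta> X \<in> arr C X (g (fob F X))" "?\<zeta> \<in> arr C (g (fob F X)) X" by (simp_all add: \<eta>_def)
      show "cmp C X (g (fob F X)) X ?\<zeta> (\<eta> X) = ident C X"
        by (rule inj[of X X]) (simp_all add: \<eta>_def additive_functorD(5)[OF F] ee' comp ident)
      show "cmp C (g (fob F X)) X (g (fob F X)) (\<eta> X) ?\<zeta> = ident C (g (fob F X))"
        by (rule inj[of "g (fob F X)" "g (fob F X)"]) (simp_all add: \<eta>_def additive_functorD(5)[OF
            F] e'e comp ident)
    qed
    moreover have "\<eta> \<in> nat_trans C C id_functor (comp_functor G F)"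
      unfolding nat_trans_def
    proof (intro CollectI conjI ballI)
      fix X Y f assume [simp]: "X \<in> obj C" "Y \<in> obj C" "f \<in> arr C X Y"
      let ?FX = "fob F X" and ?FY = "fob F Y" and ?f = "fmor F X Y f"
      have [simp]: "?f \<in> arr D ?FX ?FY" by (simp add: additive_functorD(4)[OF F])
      have "cmp D ?FX (fob F (g ?FX)) (fob F (g ?FY)) (m ?FX ?FY ?f) (e' ?FX)
          = cmp D ?FX ?FY (fob F (g ?FY)) (e' ?FY) (cmp D ?FX ?FX ?FY ?f (cmp D ?FX (fob F (g
              ?FX)) ?FX (e ?FX) (e' ?FX)))"
        by (simp add: m_def D.cmp_assoc D.cmp_closed)
      also have "\<dots> = cmp D ?FX ?FY (fob F (g ?FY)) (e' ?FY) ?f" by (simp add: ee' D.cmp_ident_right)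
      finally have "cmp C X Y (g ?FY) (\<eta> Y) f = cmp C X (g ?FX) (g ?FY) (P (g ?FX) (g ?FY) (m ?FX
          ?FY ?f)) (\<eta> X)"
        by (intro inj[of X "g ?FY"]) (simp_all add: \<eta>_def additive_functorD(5)[OF F] comp)
      then show "cmp C (fob id_functor X) (fob id_functor Y) (fob (comp_functor G F) Y) (\<eta> Y)
          (fmor id_functor X Y f)
         = cmp C (fob id_functor X) (fob (comp_functor G F) X) (fob (comp_functor G F) Y) (fmor
             (comp_functor G F) X Y f) (\<eta> X)"
        by (simp add: id_functor_def comp_functor_def G_def)
    qed (auto simp: \<eta>_def id_functor_def comp_functor_def G_def)
    ultimately show ?thesis
      unfolding naturally_isomorphic_def by (auto simp: id_functor_def comp_functor_def G_def)
  qed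
  have "naturally_isomorphic D D (comp_functor F G) id_functor"
    unfolding naturally_isomorphic_def
  proof
    show "restrict e (obj D) \<in> nat_trans D D (comp_functor F G) id_functor"
      unfolding nat_trans_def
    proof (intro CollectI conjI ballI)
      fix Y Z k assume [simp]: "Y \<in> obj D" "Z \<in> obj D" "k \<in> arr D Y Z"
      have "cmp D (fob F (g Y)) (fob F (g Z)) Z (e Z) (m Y Z k) = cmp D (fob F (g Y)) Y Z k (e Y)"
        by (simp add: m_def D.cmp_assoc D.cmp_closed ee' D.cmp_ident_left)
      then show "cmp D (fob (comp_functor F G) Y) (fob (comp_functor F G) Z) (fob id_functor Z)
          (restrict e (obj D) Z) (fmor (comp_functor F G) Y Z k)
        = cmp D (fob (comp_functor F G) Y) (fob id_functor Y) (fob id_functor Z) (fmor id_functor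
            Y Z k) (restrict e (obj D) Y)"
        by (simp add: id_functor_def comp_functor_def G_def)
    qed (auto simp: id_functor_def comp_functor_def G_def)
    show "\<forall>Y\<in>obj D. is_iso D (fob (comp_functor F G) Y) (fob id_functor Y) (restrict e (obj D) Y)"
      using e' e'e ee' by (auto simp: is_iso_def id_functor_def comp_functor_def G_def intro!:
          bexI[of _ "e' _"])
  qed
  with F G unit show ?thesis unfolding is_equivalence_def by blast
qed

text \<open>
  The first isomorphism theorem for additive categories: when the ideal is the kernel of \<open>F\<close>, its
  cosets are the fibres of \<open>F\<close> on hom-groups, so \<open>F\<close> descends to a bijection on cosets. In particular
  the ideal consists of normal subgroups because kernels do.
\<close>

lemma quotient_equivalence:
  assumes "preadditive_category C" "preadditive_category D" and F: "additive_functor C D F"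
    and ker: "\<And>X Y. \<lbrakk>X \<in> obj C; Y \<in> obj C\<rbrakk>
        \<Longrightarrow> factoring C A X Y = kernel (Mor C X Y) (Mor D (fob F X) (fob F Y)) (fmor F X Y)"
    and full: "\<And>X Y k. \<lbrakk>X \<in> obj C; Y \<in> obj C; k \<in> arr D (fob F X) (fob F Y)\<rbrakk>
        \<Longrightarrow> \<exists>f \<in> arr C X Y. fmor F X Y f = k"
    and ess: "\<And>Y. Y \<in> obj D \<Longrightarrow> \<exists>X \<in> obj C. isomorphic D (fob F X) Y"
  shows "equivalent_categories (quotient_cat C A) D"
proof -
  interpret C: preadditive_category C by fact
  interpret D: preadditive_category D by fact
  have FC[simp]: "fob F X \<in> obj D" if "X \<in> obj C" for X using additive_functorD(1)[OF F that] .
  have gh: "group_hom (Mor C X Y) (Mor D (fob F X) (fob F Y)) (fmor F X Y)" if "X \<in> obj C" "Y \<in> obj C" for X Y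
    using that additive_functorD(3)[OF F] by (simp add: group_hom_def group_hom_axioms_def
        C.group_Mor D.group_Mor)
  define cl where "cl X Y f = {f' \<in> arr C X Y. fmor F X Y f' = fmor F X Y f}" for X Y f
  have coset: "factoring C A X Y #>\<^bsub>Mor C X Y\<^esub> f = cl X Y f"
    if "X \<in> obj C" "Y \<in> obj C" "f \<in> arr C X Y" for X Y f
  proof -
    interpret h: group_hom "Mor C X Y" "Mor D (fob F X) (fob F Y)" "fmor F X Y" using gh that by blast
    show ?thesis
    proof (intro Set.set_eqI iffI)
      fix x assume "x \<in> cl X Y f"
      then have x: "x \<in> arr C X Y" "fmor F X Y x = fmor F X Y f" by (auto simp: cl_def)
      then have "x \<otimes>\<^bsub>Mor C X Y\<^esub> inv\<^bsub>Mor C X Y\<^esub> f \<in> factoring C A X Y"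
        using that by (simp add: ker kernel_def)
      moreover have "x = (x \<otimes>\<^bsub>Mor C X Y\<^esub> inv\<^bsub>Mor C X Y\<^esub> f) \<otimes>\<^bsub>Mor C X Y\<^esub> f"
        using x that by (simp add: h.G.m_assoc)
      ultimately show "x \<in> factoring C A X Y #>\<^bsub>Mor C X Y\<^esub> f" unfolding r_coset_def by blast
    qed (use that in \<open>auto simp: r_coset_def ker kernel_def cl_def\<close>)
  qed
  let ?Q = "quotient_cat C A"
  have arrQ: "arr ?Q X Y = cl X Y ` arr C X Y" if "X \<in> obj C" "Y \<in> obj C" for X Y
    using that coset by (auto simp: quotient_cat_def FactGroup_def RCOSETS_def image_iff)
  have identQ: "ident ?Q X = cl X X (ident C X)" if "X \<in> obj C" for X
    using that by (simp add: quotient_cat_def coset C.ident_closed)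
  have cmpQ: "cmp ?Q X Y Z (cl Y Z g) (cl X Y f) = cl X Z (cmp C X Y Z g f)"
    if "X \<in> obj C" "Y \<in> obj C" "Z \<in> obj C" "f \<in> arr C X Y" "g \<in> arr C Y Z" for X Y Z f g
  proof -
    have "factoring C A X Z #>\<^bsub>Mor C X Z\<^esub> cmp C X Y Z g' f' = cl X Z (cmp C X Y Z g f)"
      if "g' \<in> cl Y Z g" "f' \<in> cl X Y f" for g' f'
      using that \<open>X \<in> _\<close> \<open>Y \<in> _\<close> \<open>Z \<in> _\<close> \<open>f \<in> _\<close> \<open>g \<in> _\<close>
      by (auto simp: cl_def coset C.cmp_closed additive_functorD(5)[OF F])
    moreover have "g \<in> cl Y Z g" "f \<in> cl X Y f" using that by (auto simp: cl_def)
    ultimately show ?thesis unfolding quotient_cat_def by auto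
  qed
  define \<Phi> where "\<Phi> = \<lparr>fob = fob F, fmor = (\<lambda>X Y K. the_elem (fmor F X Y ` K))\<rparr>"
  have \<Phi>: "fmor \<Phi> X Y (cl X Y f) = fmor F X Y f" if "f \<in> arr C X Y" for X Y f
  proof -
    have "fmor F X Y ` cl X Y f = {fmor F X Y f}" using that by (auto simp: cl_def)
    then show ?thesis by (simp add: \<Phi>_def)
  qed
  have obQ: "obj ?Q = obj C" and fob: "fob \<Phi> = fob F" by (simp_all add: quotient_cat_def \<Phi>_def)
  have "is_equivalence ?Q D \<Phi>"
  proof (rule equivalenceI)
    show "additive_functor ?Q D \<Phi>"
      unfolding additive_functor_def obQ fob
    proof (intro conjI ballI)
      fix X Y assume "X \<in> obj C" "Y \<in> obj C"
      then interpret h: group_hom "Mor C X Y" "Mor D (fob F X) (fob F Y)" "fmor F X Y" using gh by blast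
      show "fmor \<Phi> X Y \<in> hom (Mor ?Q X Y) (Mor D (fob F X) (fob F Y))"
        using h.FactGroup_hom \<open>X \<in> _\<close> \<open>Y \<in> _\<close> by (simp add: quotient_cat_def \<Phi>_def ker)
    qed (auto simp: identQ arrQ \<Phi> cmpQ additive_functorD(2,5)[OF F] C.ident_closed C.cmp_closed)
  next
    fix X Y assume XY: "X \<in> obj ?Q" "Y \<in> obj ?Q"
    then interpret h: group_hom "Mor C X Y" "Mor D (fob F X) (fob F Y)" "fmor F X Y" using gh obQ by blast
    show "group (Mor ?Q X Y)"
      using normal.factorgroup_is_group[OF h.normal_kernel] XY by (simp add: quotient_cat_def ker)
    have "inj_on (fmor \<Phi> X Y) (arr ?Q X Y)"
      using XY by (simp add: inj_on_def obQ arrQ \<Phi>) (simp add: cl_def)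
    moreover have "fmor \<Phi> X Y ` arr ?Q X Y = arr D (fob \<Phi> X) (fob \<Phi> Y)"
      using XY full by (force simp: obQ fob arrQ \<Phi> image_iff additive_functorD(4)[OF F])
    ultimately show "bij_betw (fmor \<Phi> X Y) (arr ?Q X Y) (arr D (fob \<Phi> X) (fob \<Phi> Y))"
      by (simp add: bij_betw_def)
  qed (use ess in \<open>auto simp: \<open>preadditive_category D\<close> obQ fob arrQ identQ cmpQ C.ident_closed C.cmp_closed\<close>)
  then show ?thesis unfolding equivalent_categories_def by blast
qed

section \<open>Exact sequences in triangulated categories\<close>

abbreviation zero_mor :: "('o, 'm, 'x) acat_scheme \<Rightarrow> 'o \<Rightarrow> 'o \<Rightarrow> 'm" where
  "zero_mor C X Y \<equiv> \<one>\<^bsub>Mor C X Y\<^esub>"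

abbreviation neg_mor :: "('o, 'm, 'x) acat_scheme \<Rightarrow> 'o \<Rightarrow> 'o \<Rightarrow> 'm \<Rightarrow> 'm" where
  "neg_mor C X Y f \<equiv> inv\<^bsub>Mor C X Y\<^esub> f"

context preadditive_category
begin

lemma neg_neg: "\<lbrakk>X \<in> obj C; Y \<in> obj C; f \<in> arr C X Y\<rbrakk> \<Longrightarrow> neg_mor C X Y (neg_mor C X Y f) = f"
  by (simp add: group.inv_inv group_Mor)

lemma neg_zero: "\<lbrakk>X \<in> obj C; Y \<in> obj C\<rbrakk> \<Longrightarrow> neg_mor C X Y (zero_mor C X Y) = zero_mor C X Y"
  by (simp add: group.is_monoid group_Mor monoid.inv_one)

lemma neg_inject:
  "\<lbrakk>X \<in> obj C; Y \<in> obj C; f \<in> arr C X Y; g \<in> arr C X Y; neg_mor C X Y f = neg_mor C X Y g\<rbrakk> \<Longrightarrow> f = g"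
  by (metis neg_neg)

lemma diff_zero_iff:
  assumes "X \<in> obj C" "Y \<in> obj C" "f \<in> arr C X Y" "g \<in> arr C X Y"
  shows "f \<otimes>\<^bsub>Mor C X Y\<^esub> neg_mor C X Y g = zero_mor C X Y \<longleftrightarrow> f = g"
proof -
  interpret group "Mor C X Y" using assms group_Mor by blast
  show ?thesis using assms(3,4) by (metis inv_closed inv_equality inv_inv r_inv)
qed

end

context triangulated_category
begin

lemma shift_functor: "additive_functor T T (shift T)"
  using shift_equivalence by (simp add: is_equivalence_def)

lemma sh_obj: "X \<in> obj T \<Longrightarrow> sh T X \<in> obj T"
  using additive_functorD(1)[OF shift_functor] .

lemma sh_arr: "\<lbrakk>X \<in> obj T; Y \<in> obj T; f \<in> arr T X Y\<rbrakk> \<Longrightarrow> sh_mor T X Y f \<in> arr T (sh T X) (sh T Y)"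
  using additive_functorD(4)[OF shift_functor] .

lemma sh_cmp:
  "\<lbrakk>X \<in> obj T; Y \<in> obj T; Z \<in> obj T; f \<in> arr T X Y; g \<in> arr T Y Z\<rbrakk> \<Longrightarrow>
     sh_mor T X Z (cmp T X Y Z g f) = cmp T (sh T X) (sh T Y) (sh T Z) (sh_mor T Y Z g) (sh_mor T X Y f)"
  using additive_functorD(5)[OF shift_functor] .

lemma sh_ident: "X \<in> obj T \<Longrightarrow> sh_mor T X X (ident T X) = ident T (sh T X)"
  using additive_functorD(2)[OF shift_functor] .

lemma sh_hom:
  "\<lbrakk>X \<in> obj T; Y \<in> obj T\<rbrakk> \<Longrightarrow> group_hom (Mor T X Y) (Mor T (sh T X) (sh T Y)) (sh_mor T X Y)"
  using additive_functorD(3)[OF shift_functor]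
  by (simp add: group_hom_def group_hom_axioms_def group_Mor sh_obj)

lemma sh_zero: "\<lbrakk>X \<in> obj T; Y \<in> obj T\<rbrakk> \<Longrightarrow> sh_mor T X Y (zero_mor T X Y) = zero_mor T (sh T X) (sh T Y)"
  using group_hom.hom_one[OF sh_hom] .

lemma sh_faithful:
  "\<lbrakk>sh_mor T X Y f = sh_mor T X Y g; X \<in> obj T; Y \<in> obj T; f \<in> arr T X Y; g \<in> arr T X Y\<rbrakk> \<Longrightarrow> f = g"
  using equivalence_faithful[OF preadditive_category_axioms shift_equivalence] by (auto dest: inj_onD)

lemma sh_full:
  assumes "X \<in> obj T" "Y \<in> obj T" "g \<in> arr T (sh T X) (sh T Y)"
  obtains f where "f \<in> arr T X Y" "sh_mor T X Y f = g"
  using equivalence_full[OF preadditive_category_axioms preadditive_category_axioms shift_equivalence] assms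
  by blast

lemma sh_zero_object: "is_zero_object T Z \<Longrightarrow> is_zero_object T (sh T Z)"
  using sh_ident[of Z] sh_zero[of Z Z] by (auto simp: is_zero_object_def sh_obj)

lemmas closure_rules = cmp_closed zero_closed neg_closed add_closed ident_closed sh_obj sh_arr

lemma tri_rotated:
  "tri T X Y Z f g h \<Longrightarrow> tri T Y Z (sh T X) g h (neg_mor T (sh T X) (sh T Y) (sh_mor T X Y f))"
  using tri_rotate tri_closed by metis

text \<open>
  Compare with the trivial triangle \<open>X \<rightarrow> X \<rightarrow> 0\<close>: the composite factors through \<open>0\<close>.
\<close>

lemma tri_cmp_zero:
  assumes "tri T X Y Z f g h"
  shows "cmp T X Y Z g f = zero_mor T X Z"
proof -
  note [simp] = tri_closed[OF assms]
  obtain N where N: "is_zero_object T N" using ex_zero_object by blast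
  then have [simp]: "N \<in> obj T" by (simp add: is_zero_object_def)
  obtain c where "c \<in> arr T N Z" "cmp T X N Z c (zero_mor T X N) = cmp T X Y Z g f"
    using tri_morphism[OF tri_ident[OF _ N] assms, of X "ident T X" f] by (auto simp: ident_closed)
  then show ?thesis by (simp add: cmp_zero_right)
qed

text \<open>
  Exactness of \<open>\<T>(A, -)\<close> at \<open>Y\<close>. The square formed by \<open>y\<close> and \<open>0\<close> extends to a morphism from the
  rotated triangle \<open>A \<rightarrow> 0 \<rightarrow> A[1]\<close>; its third component is the shift of the desired lift, as the
  shift is full and faithful.
\<close>

lemma tri_lift:
  assumes tri: "tri T X Y Z f g h" and A: "A \<in> obj T" and y: "y \<in> arr T A Y"
    and gy: "cmp T A Y Z g y = zero_mor T A Z"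
  shows "\<exists>x \<in> arr T A X. cmp T A X Y f x = y"
proof -
  note [simp] = tri_closed[OF tri] A y sh_obj sh_arr
  obtain N where N: "is_zero_object T N" using ex_zero_object by blast
  then have [simp]: "N \<in> obj T" by (simp add: is_zero_object_def)
  obtain c where c: "c \<in> arr T (sh T A) (sh T X)"
    "cmp T (sh T A) (sh T A) (sh T Y) (sh_mor T A Y y) (neg_mor T (sh T A) (sh T A) (sh_mor T A A (ident T A)))
      = cmp T (sh T A) (sh T X) (sh T Y) (neg_mor T (sh T X) (sh T Y) (sh_mor T X Y f)) c"
    using tri_morphism[OF tri_rotated[OF tri_ident[OF A N]] tri_rotated[OF tri] y, of "zero_mor T N Z"]
    by (auto simp: gy zero_closed cmp_zero_left)
  then obtain x where x: "x \<in> arr T A X" "sh_mor T A X x = c"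
    using sh_full[of A X c] by auto
  have "neg_mor T (sh T A) (sh T Y) (sh_mor T A Y y)
      = neg_mor T (sh T A) (sh T Y) (cmp T (sh T A) (sh T X) (sh T Y) (sh_mor T X Y f) c)"
    using c by (simp add: sh_ident ident_closed cmp_neg_left cmp_neg_right cmp_ident_right)
  then have "sh_mor T A Y y = cmp T (sh T A) (sh T X) (sh T Y) (sh_mor T X Y f) c"
    by (rule neg_inject[rotated -1]) (simp_all add: c(1) cmp_closed)
  then have "sh_mor T A Y y = sh_mor T A Y (cmp T A X Y f x)"
    using x by (simp add: sh_cmp)
  then have "y = cmp T A X Y f x" using sh_faithful x by (simp add: cmp_closed)
  with x show ?thesis by blast
qed

text \<open>
  Exactness of \<open>\<T>(-, A)\<close> at \<open>Y\<close>, by comparison with the triangle \<open>0 \<rightarrow> A \<rightarrow> A\<close>.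
\<close>

lemma tri_extend:
  assumes tri: "tri T X Y Z f g h" and A: "A \<in> obj T" and y: "y \<in> arr T Y A"
    and yf: "cmp T X Y A y f = zero_mor T X A"
  shows "\<exists>z \<in> arr T Z A. cmp T Y Z A z g = y"
proof -
  note [simp] = tri_closed[OF tri] A y sh_obj sh_arr
  obtain N where N: "is_zero_object T N" using ex_zero_object by blast
  then have [simp]: "N \<in> obj T" by (simp add: is_zero_object_def)
  have "tri T N A A (zero_mor T N A) (ident T A) (zero_mor T A (sh T N))"
    using tri_ident[OF A sh_zero_object[OF N]] tri_rotate[of N A A "zero_mor T N A" "ident T A"
        "zero_mor T A (sh T N)"]
    by (simp add: zero_closed ident_closed sh_zero neg_zero)
  from tri_morphism[OF tri this zero_closed y] show ?thesis
    by (auto simp: yf cmp_zero_right zero_closed cmp_ident_left)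
qed

text \<open>
  Rotation backwards. Since the shift is only an equivalence, the third vertex is a shift only up to
  an isomorphism \<open>s\<close>, which is absorbed into the map towards it.
\<close>

lemma tri_unrotate:
  assumes tri: "tri T A B C f g h"
  obtains Z z s where "tri T Z A B z f (cmp T B C (sh T Z) s g)" "is_iso T C (sh T Z) s"
proof -
  note [simp] = tri_closed[OF tri] sh_obj sh_arr
  obtain Z where [simp]: "Z \<in> obj T" and "isomorphic T (sh T Z) C"
    using equivalence_essentially_surjective[OF shift_equivalence, of C] by auto
  then obtain t where "is_iso T (sh T Z) C t" by (auto simp: isomorphic_def)
  then obtain s where t: "t \<in> arr T (sh T Z) C" and s: "is_iso T C (sh T Z) s"
    and ts: "cmp T C (sh T Z) C t s = ident T C" and sa: "s \<in> arr T C (sh T Z)"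
    by (auto simp: is_iso_def)
  note [simp] = t sa
  obtain z where [simp]: "z \<in> arr T Z A" and z: "sh_mor T Z A z = neg_mor T (sh T Z) (sh T A) (cmp
      T (sh T Z) C (sh T A) h t)"
    using sh_full[of Z A "neg_mor T (sh T Z) (sh T A) (cmp T (sh T Z) C (sh T A) h t)"] by (auto
        simp: closure_rules)
  have "tri T A B (sh T Z) f (cmp T B C (sh T Z) s g) (cmp T (sh T Z) C (sh T A) h t)"
    by (rule tri_iso[OF tri _ _ _ _ _ _ is_iso_ident is_iso_ident s])
      (simp_all add: cmp_closed cmp_ident_left cmp_ident_right sh_ident cmp_assoc[symmetric] ts)
  then have "tri T Z A B z f (cmp T B C (sh T Z) s g)"
    by (subst tri_rotate) (simp_all add: cmp_closed z neg_neg)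
  with s that show thesis by blast
qed

text \<open>
  When two of the vertices already are shifts, rotating back needs no change of objects.
\<close>

lemma tri_unrotate_twice:
  assumes tri: "tri T A (sh T B) (sh T C) u v w" and [simp]: "B \<in> obj T" "C \<in> obj T"
  obtains f g where "tri T B C A f g u"
proof -
  note [simp] = tri_closed[OF tri] sh_obj sh_arr
  obtain f where [simp]: "f \<in> arr T B C" and f: "sh_mor T B C f = neg_mor T (sh T B) (sh T C) v"
    using sh_full[of B C "neg_mor T (sh T B) (sh T C) v"] by (auto simp: closure_rules)
  obtain g where [simp]: "g \<in> arr T C A" and g: "sh_mor T C A g = neg_mor T (sh T C) (sh T A) w"
    using sh_full[of C A "neg_mor T (sh T C) (sh T A) w"] by (auto simp: closure_rules)
  have "tri T C A (sh T B) g u v"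
    by (subst tri_rotate) (simp_all add: g neg_neg tri)
  then have "tri T B C A f g u"
    by (subst tri_rotate) (simp_all add: f neg_neg)
  then show thesis using that by blast
qed

text \<open>
  The complement of a retract is the cone \<open>Y\<close> of the section \<open>s\<close>: the connecting map vanishes, being
  \<open>r[1] s[1] h\<close> with \<open>s[1] h = 0\<close>, so \<open>P \<rightarrow> Y\<close> has a section, which is then corrected to be killed by \<open>r\<close>.
\<close>

lemma retract_is_summand:
  assumes [simp]: "X \<in> obj T" "P \<in> obj T" "s \<in> arr T X P" "r \<in> arr T P X"
    and rs: "cmp T X P X r s = ident T X"
  shows "\<exists>Y \<in> obj T. is_biproduct T X Y P"
proof -
  obtain Y q h where tri: "tri T X P Y s q h" using tri_complete[of X P s] by auto
  note [simp] = tri_closed[OF tri] closure_rules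
  have "h = cmp T Y (sh T X) (sh T X) (sh_mor T X X (cmp T X P X r s)) h"
    by (simp add: rs sh_ident cmp_ident_left)
  also have "\<dots> = cmp T Y (sh T P) (sh T X) (sh_mor T P X r) (cmp T Y (sh T X) (sh T P) (sh_mor T X P s) h)"
    by (simp add: sh_cmp cmp_assoc)
  also have "cmp T Y (sh T X) (sh T P) (sh_mor T X P s) h = zero_mor T Y (sh T P)"
  proof (rule neg_inject)
    have "cmp T Y (sh T X) (sh T P) (neg_mor T (sh T X) (sh T P) (sh_mor T X P s)) h = zero_mor T Y (sh T P)"
      by (rule tri_cmp_zero[OF tri_rotated[OF tri_rotated[OF tri]]]) 
    then show "neg_mor T Y (sh T P) (cmp T Y (sh T X) (sh T P) (sh_mor T X P s) h) = neg_mor T Y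
        (sh T P) (zero_mor T Y (sh T P))"
      by (simp add: cmp_neg_left neg_zero)
  qed simp_all
  finally have h: "h = zero_mor T Y (sh T X)" by (simp add: cmp_zero_right)
  have "cmp T Y Y (sh T X) h (ident T Y) = zero_mor T Y (sh T X)" by (simp add: h cmp_ident_right)
  then obtain t where [simp]: "t \<in> arr T Y P" and qt: "cmp T Y P Y q t = ident T Y"
    using tri_lift[OF tri_rotated[OF tri], of Y "ident T Y"] by auto
  have qs: "cmp T X P Y q s = zero_mor T X Y" by (rule tri_cmp_zero[OF tri])
  define j where "j = t \<otimes>\<^bsub>Mor T Y P\<^esub> neg_mor T Y P (cmp T Y X P s (cmp T Y P X r t))"
  have [simp]: "j \<in> arr T Y P" by (simp add: j_def)
  have rj: "cmp T Y P X r j = zero_mor T Y X"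
    unfolding j_def by (simp add: cmp_add_right cmp_neg_right cmp_assoc rs cmp_ident_left group_Mor group.r_inv)
  have qj: "cmp T Y P Y q j = ident T Y"
    unfolding j_def by (simp add: cmp_add_right cmp_neg_right cmp_assoc qs qt cmp_zero_left
        neg_zero group_Mor group.is_monoid monoid.r_one)
  define e where "e = cmp T P X P s r \<otimes>\<^bsub>Mor T P P\<^esub> cmp T P Y P j q"
  have [simp]: "e \<in> arr T P P" by (simp add: e_def)
  define d where "d = ident T P \<otimes>\<^bsub>Mor T P P\<^esub> neg_mor T P P e"
  have [simp]: "d \<in> arr T P P" by (simp add: d_def)
  have qd: "cmp T P P Y q d = zero_mor T P Y"
    unfolding d_def e_def
    by (simp add: cmp_add_right cmp_neg_right cmp_assoc qs qj cmp_zero_left cmp_ident_left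
        cmp_ident_right group_Mor group.is_monoid monoid.l_one group.r_inv)
  have rd: "cmp T P P X r d = zero_mor T P X"
    unfolding d_def e_def
    by (simp add: cmp_add_right cmp_neg_right cmp_assoc rs rj cmp_zero_left cmp_ident_left
        cmp_ident_right group_Mor group.is_monoid monoid.r_one group.r_inv)
  obtain x where [simp]: "x \<in> arr T P X" and x: "cmp T P X P s x = d"
    using tri_lift[OF tri _ _ qd] by auto
  have "x = cmp T P P X r d"
    by (simp add: x[symmetric] cmp_assoc rs cmp_ident_left)
  then have "d = zero_mor T P P" using rd x by (simp add: cmp_zero_right)
  then have "e = ident T P" unfolding d_def using diff_zero_iff[of P P "ident T P" e] by simp
  then have "is_biproduct T X Y P"
    unfolding is_biproduct_def e_def using rs qj qs rj
    by (intro conjI bexI[of _ s] bexI[of _ j] bexI[of _ r] bexI[of _ q]) simp_all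
  then show ?thesis by force
qed

end

section \<open>Presheaves of abelian groups\<close>

abbreviation presheaf_on :: "('o, 'm, 'x) acat_scheme \<Rightarrow> 'o set \<Rightarrow> ('o, 'm) presheaf \<Rightarrow> bool" where
  "presheaf_on C \<U> F \<equiv> additive_functor (op_cat (full_subcat C \<U>)) Ab F"

abbreviation presheaf_maps ::
    "('o, 'm, 'x) acat_scheme \<Rightarrow> 'o set \<Rightarrow> ('o, 'm) presheaf \<Rightarrow> ('o, 'm) presheaf \<Rightarrow> ('o \<Rightarrow> 'm \<Rightarrow> 'm) set" where
  "presheaf_maps C \<U> F G \<equiv> nat_trans (op_cat (full_subcat C \<U>)) Ab F G"

lemma presheafD:
  assumes "presheaf_on C \<U> F" and X: "X \<in> \<U>"
  shows "comm_group (fob F X)"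
    and "\<lbrakk>Y \<in> \<U>; f \<in> arr C Y X\<rbrakk> \<Longrightarrow> fmor F X Y f \<in> hom (fob F X) (fob F Y)"
    and "\<lbrakk>Y \<in> \<U>; f \<in> arr C Y X; x \<in> carrier (fob F X)\<rbrakk> \<Longrightarrow> fmor F X Y f x \<in> carrier (fob F Y)"
    and "\<lbrakk>Y \<in> \<U>; Z \<in> \<U>; f \<in> arr C Y X; g \<in> arr C Z Y; x \<in> carrier (fob F X)\<rbrakk>
      \<Longrightarrow> fmor F X Z (cmp C Z Y X f g) x = fmor F Y Z g (fmor F X Y f x)"
proof -
  have obj: "Y \<in> obj (op_cat (full_subcat C \<U>)) \<longleftrightarrow> Y \<in> \<U>" for Y
    by (simp add: op_cat_def full_subcat_def)
  note F = additive_functorD[OF assms(1), unfolded obj, OF X]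
  show "comm_group (fob F X)" using F(1) by (simp add: Ab_def)
  show hom: "fmor F X Y f \<in> hom (fob F X) (fob F Y)" if "Y \<in> \<U>" "f \<in> arr C Y X" for Y f
    using F(4)[of Y f] that by (simp add: Ab_def op_cat_def full_subcat_def)
  show "fmor F X Y f x \<in> carrier (fob F Y)" if "Y \<in> \<U>" "f \<in> arr C Y X" "x \<in> carrier (fob F X)" for Y f x
    using hom[OF that(1,2)] that(3) by (auto simp: hom_def)
  show "fmor F X Z (cmp C Z Y X f g) x = fmor F Y Z g (fmor F X Y f x)"
    if "Y \<in> \<U>" "Z \<in> \<U>" "f \<in> arr C Y X" "g \<in> arr C Z Y" "x \<in> carrier (fob F X)" for Y Z f g x
    using F(5)[of Y Z f g] that by (simp add: Ab_def op_cat_def full_subcat_def compose_def)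
qed

lemma presheaf_group_hom:
  assumes "presheaf_on C \<U> F" "X \<in> \<U>" "Y \<in> \<U>" "f \<in> arr C Y X"
  shows "group_hom (fob F X) (fob F Y) (fmor F X Y f)"
  using presheafD[OF assms(1)] assms(2-4)
  by (simp add: group_hom_def group_hom_axioms_def comm_group.axioms(2))

text \<open>
  Equality of extensional maps is equality on elements, so naturality can be tested there.
\<close>

lemma presheaf_maps_iff:
  "\<eta> \<in> presheaf_maps C \<U> F G \<longleftrightarrow> \<eta> \<in> extensional \<U> \<and>
     (\<forall>X \<in> \<U>. \<eta> X \<in> hom (fob F X) (fob G X) \<inter> extensional (carrier (fob F X))) \<and>
     (\<forall>X \<in> \<U>. \<forall>Y \<in> \<U>. \<forall>f \<in> arr C Y X. \<forall>x \<in> carrier (fob F X).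
        \<eta> Y (fmor F X Y f x) = fmor G X Y f (\<eta> X x))"
proof -
  have eq: "compose A p q = compose A p' q' \<longleftrightarrow> (\<forall>x \<in> A. p (q x) = p' (q' x))"
    for A :: "'m set" and p q p' q' :: "'m \<Rightarrow> 'm"
  proof
    assume "compose A p q = compose A p' q'"
    then have "compose A p q x = compose A p' q' x" for x by simp
    then show "\<forall>x \<in> A. p (q x) = p' (q' x)" by (metis compose_eq)
  qed (simp add: compose_def cong: restrict_cong)
  show ?thesis
    by (simp add: nat_trans_def op_cat_def full_subcat_def Ab_def eq PiE_iff) blast
qed

lemma presheaf_mapD:
  assumes "\<eta> \<in> presheaf_maps C \<U> F G" "X \<in> \<U>"
  shows "\<eta> X \<in> hom (fob F X) (fob G X)"
    and "x \<in> carrier (fob F X) \<Longrightarrow> \<eta> X x \<in> carrier (fob G X)"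
    and "\<lbrakk>Y \<in> \<U>; f \<in> arr C Y X; x \<in> carrier (fob F X)\<rbrakk>
      \<Longrightarrow> \<eta> Y (fmor F X Y f x) = fmor G X Y f (\<eta> X x)"
  using assms by (auto simp: presheaf_maps_iff hom_def)

lemma presheaf_map_group_hom:
  assumes "\<eta> \<in> presheaf_maps C \<U> F G" "presheaf_on C \<U> F" "presheaf_on C \<U> G" "X \<in> \<U>"
  shows "group_hom (fob F X) (fob G X) (\<eta> X)"
  using assms by (simp add: group_hom_def group_hom_axioms_def presheaf_mapD(1) presheafD(1)
      comm_group.axioms(2))

text \<open>
  Epimorphisms of presheaves are pointwise surjections, and they are cokernels of their kernels.
\<close>

lemma factor_through_epimorphism:
  assumes P: "presheaf_on C \<U> P" and G: "presheaf_on C \<U> G" and F: "presheaf_on C \<U> F"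
    and \<rho>: "\<rho> \<in> presheaf_maps C \<U> P G" and \<pi>: "\<pi> \<in> presheaf_maps C \<U> P F"
    and surj: "\<And>X. X \<in> \<U> \<Longrightarrow> carrier (fob G X) \<subseteq> \<rho> X ` carrier (fob P X)"
    and ker: "\<And>X u. \<lbrakk>X \<in> \<U>; u \<in> carrier (fob P X); \<rho> X u = \<one>\<^bsub>fob G X\<^esub>\<rbrakk> \<Longrightarrow> \<pi> X u = \<one>\<^bsub>fob F X\<^esub>"
  shows "\<exists>\<theta> \<in> presheaf_maps C \<U> G F. \<forall>X \<in> \<U>. \<forall>u \<in> carrier (fob P X). \<theta> X (\<rho> X u) = \<pi> X u"
proof -
  define \<theta> where "\<theta> = (\<lambda>X\<in>\<U>. \<lambda>y\<in>carrier (fob G X). \<pi> X (inv_into (carrier (fob P X)) (\<rho> X) y))"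
  have eq: "\<pi> X u = \<pi> X v" if "X \<in> \<U>" "u \<in> carrier (fob P X)" "v \<in> carrier (fob P X)" "\<rho> X u = \<rho> X v" for X u v
  proof -
    interpret r: group_hom "fob P X" "fob G X" "\<rho> X" by (rule presheaf_map_group_hom[OF \<rho> P G that(1)])
    interpret p: group_hom "fob P X" "fob F X" "\<pi> X" by (rule presheaf_map_group_hom[OF \<pi> P F that(1)])
    have "\<pi> X (u \<otimes>\<^bsub>fob P X\<^esub> inv\<^bsub>fob P X\<^esub> v) = \<one>\<^bsub>fob F X\<^esub>"
      by (rule ker) (use that in simp_all)
    then have "\<pi> X u \<otimes>\<^bsub>fob F X\<^esub> inv\<^bsub>fob F X\<^esub> (\<pi> X v) = \<one>\<^bsub>fob F X\<^esub>"
      using that by simp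
    then show ?thesis using that by (metis p.H.inv_equality p.H.inv_inv p.H.inv_closed p.hom_closed)
  qed
  have \<theta>: "\<theta> X (\<rho> X u) = \<pi> X u" if "X \<in> \<U>" "u \<in> carrier (fob P X)" for X u
  proof -
    have "\<rho> X u \<in> \<rho> X ` carrier (fob P X)" using that by blast
    from eq[OF that(1) inv_into_into[OF this] that(2) f_inv_into_f[OF this]] show ?thesis
      using presheaf_mapD(2)[OF \<rho> that(1)] that by (simp add: \<theta>_def)
  qed
  have "\<theta> \<in> presheaf_maps C \<U> G F"
    unfolding presheaf_maps_iff
  proof (intro conjI ballI)
    fix X assume X: "X \<in> \<U>"
    interpret r: group_hom "fob P X" "fob G X" "\<rho> X" by (rule presheaf_map_group_hom[OF \<rho> P G X])
    interpret p: group_hom "fob P X" "fob F X" "\<pi> X" by (rule presheaf_map_group_hom[OF \<pi> P F X])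
    have "\<theta> X y \<in> carrier (fob F X)" if "y \<in> carrier (fob G X)" for y
    proof -
      obtain u where "u \<in> carrier (fob P X)" "y = \<rho> X u" using surj[OF X] \<open>y \<in> _\<close> by blast
      with \<theta>[OF X this(1)] show ?thesis by simp
    qed
    moreover have "\<theta> X (y \<otimes>\<^bsub>fob G X\<^esub> z) = \<theta> X y \<otimes>\<^bsub>fob F X\<^esub> \<theta> X z"
      if yz: "y \<in> carrier (fob G X)" "z \<in> carrier (fob G X)" for y z
    proof -
      obtain u where u: "y = \<rho> X u" "u \<in> carrier (fob P X)"
        using subsetD[OF surj[OF X] yz(1)] by (rule imageE)
      obtain v where v: "z = \<rho> X v" "v \<in> carrier (fob P X)"
        using subsetD[OF surj[OF X] yz(2)] by (rule imageE)
      have "\<theta> X (\<rho> X (u \<otimes>\<^bsub>fob P X\<^esub> v)) = \<theta> X (\<rho> X u) \<otimes>\<^bsub>fob F X\<^esub> \<theta> X (\<rho> X v)"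
        using u(2) v(2) by (simp only: \<theta>[OF X] r.G.m_closed p.hom_mult)
      then show ?thesis using u v by simp
    qed
    ultimately show "\<theta> X \<in> hom (fob G X) (fob F X) \<inter> extensional (carrier (fob G X))"
      using X by (simp add: hom_def \<theta>_def)
  next
    fix X Y f y assume XY: "X \<in> \<U>" "Y \<in> \<U>" "f \<in> arr C Y X" "y \<in> carrier (fob G X)"
    obtain u where y: "y = \<rho> X u" and u: "u \<in> carrier (fob P X)"
      using subsetD[OF surj[OF XY(1)] XY(4)] by (rule imageE)
    have "\<theta> Y (fmor G X Y f y) = \<theta> Y (\<rho> Y (fmor P X Y f u))"
      unfolding y by (simp only: presheaf_mapD(3)[OF \<rho> XY(1-3) u])
    also have "\<dots> = \<pi> Y (fmor P X Y f u)" by (rule \<theta>[OF XY(2) presheafD(3)[OF P XY(1-3) u]])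
    also have "\<dots> = fmor F X Y f (\<theta> X y)"
      unfolding y by (simp only: \<theta>[OF XY(1) u] presheaf_mapD(3)[OF \<pi> XY(1-3) u])
    finally show "\<theta> Y (fmor G X Y f y) = fmor F X Y f (\<theta> X y)" .
  qed (simp add: \<theta>_def)
  with \<theta> show ?thesis by blast
qed

lemma isomorphic_of_equal_kernels:
  assumes P: "presheaf_on C \<U> P" and G: "presheaf_on C \<U> G" and F: "presheaf_on C \<U> F"
    and \<rho>: "\<rho> \<in> presheaf_maps C \<U> P G" and \<pi>: "\<pi> \<in> presheaf_maps C \<U> P F"
    and surj: "\<And>X. X \<in> \<U> \<Longrightarrow> carrier (fob G X) \<subseteq> \<rho> X ` carrier (fob P X)"
      "\<And>X. X \<in> \<U> \<Longrightarrow> carrier (fob F X) \<subseteq> \<pi> X ` carrier (fob P X)"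
    and ker: "\<And>X u. \<lbrakk>X \<in> \<U>; u \<in> carrier (fob P X)\<rbrakk> \<Longrightarrow> \<rho> X u = \<one>\<^bsub>fob G X\<^esub> \<longleftrightarrow> \<pi> X u = \<one>\<^bsub>fob F X\<^esub>"
  shows "isomorphic (functor_cat (op_cat (full_subcat C \<U>)) Ab) G F"
proof -
  obtain \<theta> where \<theta>: "\<theta> \<in> presheaf_maps C \<U> G F" "\<And>X u. \<lbrakk>X \<in> \<U>; u \<in> carrier (fob P X)\<rbrakk> \<Longrightarrow> \<theta> X (\<rho> X u) = \<pi> X u"
    using factor_through_epimorphism[OF P G F \<rho> \<pi> surj(1)] ker by blast
  obtain \<theta>' where \<theta>': "\<theta>' \<in> presheaf_maps C \<U> F G" "\<And>X u. \<lbrakk>X \<in> \<U>; u \<in> carrier (fob P X)\<rbrakk> \<Longrightarrow> \<theta>' X (\<pi> X u) = \<rho> X u"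
    using factor_through_epimorphism[OF P F G \<pi> \<rho> surj(2)] ker by blast
  have "\<theta>' X (\<theta> X y) = y" if "X \<in> \<U>" "y \<in> carrier (fob G X)" for X y
  proof -
    obtain u where "u \<in> carrier (fob P X)" "y = \<rho> X u" using surj(1) \<open>X \<in> _\<close> \<open>y \<in> _\<close> by blast
    with \<theta>(2)[OF \<open>X \<in> _\<close> this(1)] \<theta>'(2)[OF \<open>X \<in> _\<close> this(1)] show ?thesis by simp
  qed
  moreover have "\<theta> X (\<theta>' X y) = y" if "X \<in> \<U>" "y \<in> carrier (fob F X)" for X y
  proof -
    obtain u where "u \<in> carrier (fob P X)" "y = \<pi> X u" using surj(2) \<open>X \<in> _\<close> \<open>y \<in> _\<close> by blast
    with \<theta>(2)[OF \<open>X \<in> _\<close> this(1)] \<theta>'(2)[OF \<open>X \<in> _\<close> this(1)] show ?thesis by simp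
  qed
  ultimately have "is_iso (functor_cat (op_cat (full_subcat C \<U>)) Ab) G F \<theta>"
    unfolding is_iso_def
    by (intro conjI bexI[of _ \<theta>'])
      (use \<theta>(1) \<theta>'(1) in \<open>auto simp: functor_cat_def compose_def Ab_def op_cat_def full_subcat_def
          intro!: restrict_ext\<close>)
  then show ?thesis unfolding isomorphic_def by blast
qed

text \<open>
  The image of \<open>f\<close> under the Yoneda embedding, restricted to \<open>\<U>\<close>.
\<close>

definition post_comp :: "('o, 'm, 'x) acat_scheme \<Rightarrow> 'o set \<Rightarrow> 'o \<Rightarrow> 'o \<Rightarrow> 'm \<Rightarrow> 'o \<Rightarrow> 'm \<Rightarrow> 'm" where
  "post_comp C \<U> A B f = (\<lambda>X\<in>\<U>. \<lambda>g\<in>arr C X A. cmp C X A B f g)"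

context preadditive_category
begin

lemma representable_presheaf:
  assumes "\<U> \<subseteq> obj C" "A \<in> obj C"
  shows "presheaf_on C \<U> (representable C A)"
  unfolding additive_functor_def
proof (intro conjI ballI)
  fix X Y assume "X \<in> obj (op_cat (full_subcat C \<U>))" "Y \<in> obj (op_cat (full_subcat C \<U>))"
  then have [simp]: "X \<in> obj C" "Y \<in> obj C" "A \<in> obj C" using assms by (auto simp: op_cat_def full_subcat_def)
  show "fmor (representable C A) X Y \<in> hom (Mor (op_cat (full_subcat C \<U>)) X Y) (Mor Ab (fob
      (representable C A) X) (fob (representable C A) Y))"
    by (auto simp: hom_def op_cat_def full_subcat_def Ab_def representable_def cmp_closed
        add_closed cmp_add_left cmp_add_right intro!: restrict_ext)
next
  fix X assume "X \<in> obj (op_cat (full_subcat C \<U>))"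
  then have [simp]: "X \<in> obj C" "A \<in> obj C" using assms by (auto simp: op_cat_def full_subcat_def)
  show "fob (representable C A) X \<in> obj Ab" by (simp add: Ab_def representable_def Mor_comm_group)
  show "fmor (representable C A) X X (ident (op_cat (full_subcat C \<U>)) X) = ident Ab (fob
      (representable C A) X)"
    by (auto simp: op_cat_def full_subcat_def Ab_def representable_def cmp_ident_right intro!: restrict_ext)
next
  fix X Y Z f g assume a: "X \<in> obj (op_cat (full_subcat C \<U>))" "Y \<in> obj (op_cat (full_subcat C
      \<U>))" "Z \<in> obj (op_cat (full_subcat C \<U>))"
    and "f \<in> arr (op_cat (full_subcat C \<U>)) X Y" "g \<in> arr (op_cat (full_subcat C \<U>)) Y Z"
  then have [simp]: "X \<in> obj C" "Y \<in> obj C" "Z \<in> obj C" "A \<in> obj C" "f \<in> arr C Y X" "g \<in> arr C Z Y"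
    using assms by (auto simp: op_cat_def full_subcat_def)
  show "fmor (representable C A) X Z (cmp (op_cat (full_subcat C \<U>)) X Y Z g f) =
    cmp Ab (fob (representable C A) X) (fob (representable C A) Y) (fob (representable C A) Z)
        (fmor (representable C A) Y Z g) (fmor (representable C A) X Y f)"
    by (auto simp: op_cat_def full_subcat_def Ab_def representable_def compose_def cmp_closed
        cmp_assoc intro!: restrict_ext)
qed

lemma post_comp_map:
  assumes "\<U> \<subseteq> obj C" "A \<in> obj C" "B \<in> obj C" "f \<in> arr C A B"
  shows "post_comp C \<U> A B f \<in> presheaf_maps C \<U> (representable C A) (representable C B)"
  unfolding presheaf_maps_iff
  using assms by (auto simp: post_comp_def hom_def representable_def cmp_closed cmp_add_right
      add_closed cmp_assoc subset_iff)

lemma post_comp_add: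
  assumes "\<U> \<subseteq> obj C" "A \<in> obj C" "B \<in> obj C" "f \<in> arr C A B" "g \<in> arr C A B"
  shows "post_comp C \<U> A B (f \<otimes>\<^bsub>Mor C A B\<^esub> g) = post_comp C \<U> A B f
      \<otimes>\<^bsub>Mor (functor_cat (op_cat (full_subcat C \<U>)) Ab) (representable C A) (representable C B)\<^esub>
          post_comp C \<U> A B g"
  using assms by (auto simp: post_comp_def functor_cat_def Ab_def op_cat_def full_subcat_def
      representable_def cmp_add_left subset_iff intro!: restrict_ext)

lemma post_comp_ident:
  assumes "\<U> \<subseteq> obj C" "A \<in> obj C"
  shows "post_comp C \<U> A A (ident C A) = ident (functor_cat (op_cat (full_subcat C \<U>)) Ab) (representable C A)"
  using assms by (auto simp: post_comp_def functor_cat_def Ab_def op_cat_def full_subcat_def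
      representable_def cmp_ident_left subset_iff intro!: restrict_ext)

lemma post_comp_cmp:
  assumes "\<U> \<subseteq> obj C" "A \<in> obj C" "B \<in> obj C" "D \<in> obj C" "f \<in> arr C A B" "g \<in> arr C B D"
  shows "post_comp C \<U> A D (cmp C A B D g f) = cmp (functor_cat (op_cat (full_subcat C \<U>)) Ab)
      (representable C A) (representable C B) (representable C D) (post_comp C \<U> B D g) (post_comp C \<U> A B f)"
  using assms by (auto simp: post_comp_def functor_cat_def Ab_def op_cat_def full_subcat_def
      representable_def compose_def cmp_closed cmp_assoc subset_iff intro!: restrict_ext)

end

section \<open>Hearts and functors on the left class of a cotorsion pair\<close>

locale cotorsion = triangulated_category T
  for T :: "('o, 'm, 'x) tcat_scheme" +
  fixes \<U> \<V> :: "'o set"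
  assumes cotorsion_pair: "cotorsion_pair T \<U> \<V>"
begin

lemma additive_U: "additive_subclass T \<U>" and additive_V: "additive_subclass T \<V>"
  and summands_U: "closed_under_summands T \<U>"
  and orthogonality: "\<forall>U \<in> \<U>. \<forall>V \<in> \<V>. arr T U (sh T V) = {zero_mor T U (sh T V)}"
  and approximations: "\<forall>X \<in> obj T. \<exists>U \<in> \<U>. \<exists>V \<in> \<V>. \<exists>f g h. tri T U X (sh T V) f g h"
  using cotorsion_pair by (simp_all add: cotorsion_pair_def)

lemma U_obj: "X \<in> \<U> \<Longrightarrow> X \<in> obj T"
  using additive_U unfolding additive_subclass_def by (elim conjE) (erule subsetD)

lemma V_obj: "X \<in> \<V> \<Longrightarrow> X \<in> obj T"
  using additive_V unfolding additive_subclass_def by (elim conjE) (erule subsetD)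

lemma U_subset: "\<U> \<subseteq> obj T"
  using U_obj by blast

lemma U_iso:
  assumes "X \<in> \<U>" "Y \<in> obj T" "is_iso T X Y s"
  shows "Y \<in> \<U>"
  using additive_U assms unfolding additive_subclass_def isomorphic_def by blast

lemma orthogonal: "\<lbrakk>X \<in> \<U>; Y \<in> \<V>; x \<in> arr T X (sh T Y)\<rbrakk> \<Longrightarrow> x = zero_mor T X (sh T Y)"
  using orthogonality by blast

lemma approximation:
  assumes "X \<in> obj T"
  obtains U V f g h where "U \<in> \<U>" "V \<in> \<V>" "tri T U X (sh T V) f g h"
  using approximations assms by blast

text \<open>
  \<open>\<U>\<close> is the left orthogonal of \<open>\<V>[1]\<close>: if the map \<open>X \<rightarrow> V[1]\<close> in an approximation triangle is zero,
  \<open>X\<close> is a retract of an object of \<open>\<U>\<close>.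
\<close>

lemma U_of_orthogonal:
  assumes X: "X \<in> obj T" and orth: "\<And>Y x. \<lbrakk>Y \<in> \<V>; x \<in> arr T X (sh T Y)\<rbrakk> \<Longrightarrow> x = zero_mor T X (sh T Y)"
  shows "X \<in> \<U>"
proof -
  obtain U V f g h where UV: "U \<in> \<U>" "V \<in> \<V>" and tri: "tri T U X (sh T V) f g h"
    using approximation[OF X] .
  note t = tri_closed[OF tri]
  have "g = zero_mor T X (sh T V)" using orth UV t by blast
  then have "cmp T X X (sh T V) g (ident T X) = zero_mor T X (sh T V)"
    using X t by (simp add: cmp_ident_right)
  then obtain s where "s \<in> arr T X U" "cmp T X U X f s = ident T X"
    using tri_lift[OF tri X ident_closed[OF X]] by blast
  then obtain Y where "Y \<in> obj T" "is_biproduct T X Y U"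
    using retract_is_summand[of X U s f] X t by blast
  then show ?thesis
    using summands_U UV(1) X unfolding closed_under_summands_def by blast
qed

lemma U_extension_closed:
  assumes tri: "tri T A B C f g h" and AC: "A \<in> \<U>" "C \<in> \<U>"
  shows "B \<in> \<U>"
proof (rule U_of_orthogonal)
  note t = tri_closed[OF tri]
  show "B \<in> obj T" using t by blast
  fix Y x assume Y: "Y \<in> \<V>" and x: "x \<in> arr T B (sh T Y)"
  have sY: "sh T Y \<in> obj T" using Y V_obj sh_obj by blast
  have "cmp T A B (sh T Y) x f = zero_mor T A (sh T Y)"
    using orthogonal[OF AC(1) Y] cmp_closed t x sY by blast
  then obtain z where z: "z \<in> arr T C (sh T Y)" "cmp T B C (sh T Y) z g = x"
    using tri_extend[OF tri sY x] by blast
  then show "x = zero_mor T B (sh T Y)"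
    using orthogonal[OF AC(2) Y z(1)] cmp_zero_left[of B C "sh T Y" g] t sY by auto
qed

text \<open>
  Approximate \<open>X[1]\<close> and rotate back.
\<close>

lemma coapproximation:
  assumes X: "X \<in> obj T"
  obtains V U f g h where "V \<in> \<V>" "U \<in> \<U>" "tri T X V U f g h"
proof -
  obtain U V f g h where UV: "U \<in> \<U>" "V \<in> \<V>" and tri: "tri T U (sh T X) (sh T V) f g h"
    using approximation[OF sh_obj[OF X]] .
  then show thesis using tri_unrotate_twice[OF tri X V_obj] that by metis
qed

text \<open>
  The cotorsion pair has enough injectives: \<open>V\<close> in a coapproximation of \<open>X \<in> \<U>\<close> is an extension of
  objects of \<open>\<U>\<close>, hence lies in the core \<open>\<U> \<inter> \<V>\<close>.
\<close>

lemma embed_in_core: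
  assumes X: "X \<in> \<U>"
  obtains W U f g h where "W \<in> \<U> \<inter> \<V>" "U \<in> \<U>" "tri T X W U f g h"
proof -
  obtain V U f g h where "V \<in> \<V>" "U \<in> \<U>" "tri T X V U f g h"
    using coapproximation[OF U_obj[OF X]] .
  then show thesis using U_extension_closed X that by blast
qed

lemma T_plusI:
  assumes "W \<in> \<U> \<inter> \<V>" "V \<in> \<V>" "tri T W H (sh T V) f g h"
  shows "H \<in> T_plus T \<U> \<V>"
proof -
  have "sh T V \<in> shift_class T \<V>"
    using assms(2) isomorphic_refl[of "sh T V"] V_obj[of V] sh_obj[of V] unfolding shift_class_def by blast
  then show ?thesis using assms unfolding T_plus_def star_def by blast
qed

text \<open>
  The only obstruction to lifting a map \<open>U \<rightarrow> H\<close> along \<open>W \<rightarrow> H\<close> lies in \<open>\<T>(U, V[1]) = 0\<close>.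
\<close>

lemma T_plus_factor:
  assumes H: "H \<in> T_plus T \<U> \<V>" and U: "U \<in> \<U>" and x: "x \<in> arr T U H"
  obtains W w y where "W \<in> \<U> \<inter> \<V>" "w \<in> arr T W H" "y \<in> arr T U W" "cmp T U W H w y = x"
proof -
  obtain W B f g h where W: "W \<in> \<U> \<inter> \<V>" and B: "B \<in> shift_class T \<V>" and tri: "tri T W H B f g h"
    using H by (auto simp: T_plus_def star_def)
  note t = tri_closed[OF tri]
  obtain Y s where Y: "Y \<in> \<V>" and s: "is_iso T B (sh T Y) s"
    using B by (auto simp: shift_class_def isomorphic_def)
  have sY: "sh T Y \<in> obj T" and Uo: "U \<in> obj T" using Y U V_obj U_obj sh_obj by auto
  have sa: "s \<in> arr T B (sh T Y)" using s by (simp add: is_iso_def)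
  have gx: "cmp T U H B g x \<in> arr T U B" using cmp_closed Uo t x by blast
  have "cmp T U B (sh T Y) s (cmp T U H B g x) = zero_mor T U (sh T Y)"
    using orthogonal[OF U Y] cmp_closed Uo t gx sa sY by blast
  also have "\<dots> = cmp T U B (sh T Y) s (zero_mor T U B)"
    using cmp_zero_right Uo t sa sY by simp
  finally have "cmp T U H B g x = zero_mor T U B"
    using iso_cancel_left[OF s] Uo t sY gx zero_closed by blast
  then show thesis using tri_lift[OF tri Uo x] that W t by blast
qed

lemma T_minusI:
  assumes "W \<in> \<U> \<inter> \<V>" "U \<in> \<U>" and tri: "tri T H W U f g h"
  shows "H \<in> T_minus T \<U> \<V>"
proof -
  obtain Z z s where Z: "tri T Z H W z f (cmp T W U (sh T Z) s g)" "is_iso T U (sh T Z) s"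
    using tri_unrotate[OF tri] .
  then have "Z \<in> unshift_class T \<U>"
    using tri_closed[OF Z(1)] assms(2) isomorphic_sym unfolding unshift_class_def isomorphic_def by blast
  then show ?thesis using assms Z unfolding T_minus_def star_def by blast
qed

text \<open>
  Rotated, the defining triangle of \<open>\<T>\<^sup>-\<close> reads \<open>H \<rightarrow> W \<rightarrow> U\<close> with \<open>U \<in> \<U>\<close>, a resolution of \<open>H\<close>
  that makes \<open>W \<rightarrow> U\<close> a presentation of \<open>\<T>(-, H[1])\<close>.
\<close>

lemma T_minusE:
  assumes "H \<in> T_minus T \<U> \<V>"
  obtains W U f g h where "W \<in> \<U> \<inter> \<V>" "U \<in> \<U>" "tri T H W U f g h"
proof -
  obtain A W f g h where A: "A \<in> unshift_class T \<U>" and W: "W \<in> \<U> \<inter> \<V>" and tri: "tri T A H W f g h"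
    using assms by (auto simp: T_minus_def star_def)
  have "sh T A \<in> \<U>"
  proof -
    obtain Y where "Y \<in> \<U>" "isomorphic T (sh T A) Y" using A by (auto simp: unshift_class_def)
    then show ?thesis
      using isomorphic_sym[of "sh T A" Y] U_iso[of Y "sh T A"] tri_closed[OF tri] sh_obj
      unfolding isomorphic_def by blast
  qed
  then show thesis using that W tri_rotated[OF tri] by blast
qed

lemma T_plus_obj: "H \<in> T_plus T \<U> \<V> \<Longrightarrow> H \<in> obj T"
  using tri_closed unfolding T_plus_def star_def by blast

lemma T_minus_obj: "H \<in> T_minus T \<U> \<V> \<Longrightarrow> H \<in> obj T"
  using tri_closed unfolding T_minus_def star_def by blast

text \<open>
  The obstruction to lifting along \<open>h : U \<rightarrow> H[1]\<close> lies in \<open>\<T>(X, W[1]) = 0\<close>. So \<open>h\<close> generates the functor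
  \<open>\<T>(-, H[1])\<close> on \<open>\<U>\<close>.
\<close>

lemma generator_lift:
  assumes tri: "tri T H W U k g h" and W: "W \<in> \<V>" and X: "X \<in> \<U>" and x: "x \<in> arr T X (sh T H)"
  shows "\<exists>x' \<in> arr T X U. cmp T X U (sh T H) h x' = x"
proof -
  note t = tri_closed[OF tri]
  have sW: "sh T W \<in> obj T" "sh T H \<in> obj T" using t sh_obj by auto
  have "cmp T X (sh T H) (sh T W) (neg_mor T (sh T H) (sh T W) (sh_mor T H W k)) x \<in> arr T X (sh T W)"
    using U_obj[OF X] sW t x by (simp add: cmp_closed neg_closed sh_arr)
  from tri_lift[OF tri_rotated[OF tri_rotated[OF tri]] U_obj[OF X] x orthogonal[OF X W this]]
  show ?thesis .
qed

text \<open>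
  If \<open>f[1]\<close> kills the generator \<open>U \<rightarrow> H[1]\<close>, it factors through the next vertex \<open>W[1]\<close>, so \<open>f\<close> factors
  through \<open>W\<close>. Conversely maps from \<open>\<U>\<close> to \<open>W[1]\<close> vanish for \<open>W \<in> \<V>\<close>.
\<close>

lemma post_comp_zero_iff:
  assumes H: "H \<in> T_minus T \<U> \<V>" and H': "H' \<in> obj T" and f: "f \<in> arr T H H'"
  shows "(\<forall>X \<in> \<U>. \<forall>x \<in> arr T X (sh T H).
        cmp T X (sh T H) (sh T H') (sh_mor T H H' f) x = zero_mor T X (sh T H'))
      \<longleftrightarrow> f \<in> factoring T (\<U> \<inter> \<V>) H H'"
proof
  assume zero: "\<forall>X \<in> \<U>. \<forall>x \<in> arr T X (sh T H).
        cmp T X (sh T H) (sh T H') (sh_mor T H H' f) x = zero_mor T X (sh T H')"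
  obtain W U k g h where WU: "W \<in> \<U> \<inter> \<V>" "U \<in> \<U>" and tri: "tri T H W U k g h"
    using T_minusE[OF H] .
  note [simp] = tri_closed[OF tri] H' f closure_rules
  obtain z where z: "z \<in> arr T (sh T W) (sh T H')"
    "cmp T (sh T H) (sh T W) (sh T H') z (neg_mor T (sh T H) (sh T W) (sh_mor T H W k)) = sh_mor T H H' f"
    using tri_extend[OF tri_rotated[OF tri_rotated[OF tri]], of "sh T H'" "sh_mor T H H' f"] zero WU(2)
    by auto
  obtain w where w: "w \<in> arr T W H'" "sh_mor T W H' w = neg_mor T (sh T W) (sh T H') z"
    using sh_full[of W H' "neg_mor T (sh T W) (sh T H') z"] z(1) by auto
  have "sh_mor T H H' (cmp T H W H' w k) = sh_mor T H H' f"
    using z w by (simp add: sh_cmp cmp_neg_left cmp_neg_right)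
  then have "cmp T H W H' w k = f" using sh_faithful w(1) by simp
  then show "f \<in> factoring T (\<U> \<inter> \<V>) H H'"
    using WU(1) w(1) tri_closed[OF tri] unfolding factoring_def by blast
next
  assume "f \<in> factoring T (\<U> \<inter> \<V>) H H'"
  then obtain W p q where W: "W \<in> \<U> \<inter> \<V>" and p: "p \<in> arr T H W" and q: "q \<in> arr T W H'"
    and f': "f = cmp T H W H' q p" by (auto simp: factoring_def)
  have [simp]: "W \<in> obj T" "H \<in> obj T" using W U_obj T_minus_obj[OF H] by auto
  note [simp] = p q H' closure_rules
  show "\<forall>X \<in> \<U>. \<forall>x \<in> arr T X (sh T H).
        cmp T X (sh T H) (sh T H') (sh_mor T H H' f) x = zero_mor T X (sh T H')"
  proof (intro ballI)
    fix X x assume X: "X \<in> \<U>" and x[simp]: "x \<in> arr T X (sh T H)"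
    have [simp]: "X \<in> obj T" using X U_obj by blast
    have "cmp T X (sh T H) (sh T W) (sh_mor T H W p) x = zero_mor T X (sh T W)"
      using X W by (intro orthogonal) auto
    then show "cmp T X (sh T H) (sh T H') (sh_mor T H H' f) x = zero_mor T X (sh T H')"
      by (simp add: f' sh_cmp cmp_assoc[symmetric] cmp_zero_right)
  qed
qed

lemma representable_full_subcat: "representable (full_subcat T \<U>) A = representable T A"
  by (simp add: representable_def full_subcat_def)

text \<open>
  The image \<open>y\<close> of the generator \<open>h\<close> is killed by \<open>W \<rightarrow> U\<close>, as \<open>h\<close> is, and so factors through \<open>h\<close>. The
  factor agrees with \<open>\<eta>\<close> on \<open>h\<close>, hence everywhere.
\<close>

lemma post_comp_full:
  assumes H: "H \<in> T_minus T \<U> \<V>" and H'[simp]: "H' \<in> obj T"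
    and \<eta>: "\<eta> \<in> presheaf_maps T \<U> (representable T (sh T H)) (representable T (sh T H'))"
  shows "\<exists>f \<in> arr T H H'. post_comp T \<U> (sh T H) (sh T H') (sh_mor T H H' f) = \<eta>"
proof -
  obtain W U k g h where WU: "W \<in> \<U> \<inter> \<V>" "U \<in> \<U>" and tri: "tri T H W U k g h"
    using T_minusE[OF H] .
  note [simp] = tri_closed[OF tri] closure_rules
  have \<eta>_arr: "\<eta> X x \<in> arr T X (sh T H')" if "X \<in> \<U>" "x \<in> arr T X (sh T H)" for X x
    using presheaf_mapD(2)[OF \<eta> that(1)] that by (simp add: representable_def)
  have \<eta>_nat: "\<eta> Y (cmp T Y X (sh T H) x f) = cmp T Y X (sh T H') (\<eta> X x) f"
    if "X \<in> \<U>" "Y \<in> \<U>" "f \<in> arr T Y X" "x \<in> arr T X (sh T H)" for X Y x f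
    using presheaf_mapD(3)[OF \<eta> that(1-3)] that \<eta>_arr by (simp add: representable_def)
  have \<eta>_zero: "\<eta> X (zero_mor T X (sh T H)) = zero_mor T X (sh T H')" if "X \<in> \<U>" for X
    using group_hom.hom_one[OF presheaf_map_group_hom[OF \<eta> representable_presheaf representable_presheaf that]]
    by (simp add: U_subset representable_def)
  define y where "y = \<eta> U h"
  have [simp]: "y \<in> arr T U (sh T H')" unfolding y_def by (rule \<eta>_arr) (simp_all add: WU)
  have "cmp T W U (sh T H') y g = zero_mor T W (sh T H')"
    using \<eta>_nat[of U W g h] \<eta>_zero[of W] WU tri_cmp_zero[OF tri_rotated[OF tri]] by (simp add: y_def)
  then obtain z where z: "z \<in> arr T (sh T H) (sh T H')" "cmp T U (sh T H) (sh T H') z h = y"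
    using tri_extend[OF tri_rotated[OF tri], of "sh T H'" y] by auto
  obtain f where f: "f \<in> arr T H H'" "sh_mor T H H' f = z" using sh_full[of H H' z] z by auto
  have "cmp T X (sh T H) (sh T H') z x = \<eta> X x" if X: "X \<in> \<U>" and x: "x \<in> arr T X (sh T H)" for X x
  proof -
    obtain x' where x': "x' \<in> arr T X U" "cmp T X U (sh T H) h x' = x"
      using generator_lift[OF tri _ X x] WU by blast
    have "\<eta> X x = cmp T X U (sh T H') y x'" using \<eta>_nat[of U X x' h] WU X x' by (simp add: y_def)
    also have "\<dots> = cmp T X (sh T H) (sh T H') z (cmp T X U (sh T H) h x')"
      using U_obj[OF X] x'(1) z by (simp add: cmp_assoc)
    finally show ?thesis by (simp add: x')
  qed
  then have "post_comp T \<U> (sh T H) (sh T H') z = \<eta>"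
    using \<eta> unfolding presheaf_maps_iff post_comp_def
    by (intro ext) (auto simp: extensional_def representable_def restrict_def)
  with f show ?thesis by blast
qed

lemma finitely_presented_of_T_minus:
  assumes H: "H \<in> T_minus T \<U> \<V>"
  shows "finitely_presented (full_subcat T \<U>) (representable T (sh T H))"
proof -
  obtain W U k g h where WU: "W \<in> \<U> \<inter> \<V>" "U \<in> \<U>" and tri: "tri T H W U k g h"
    using T_minusE[OF H] .
  note [simp] = tri_closed[OF tri] closure_rules
  have "post_comp T \<U> W U g X ` arr T X W = kernel (Mor T X U) (Mor T X (sh T H)) (post_comp T \<U> U
      (sh T H) h X) \<and>
       post_comp T \<U> U (sh T H) h X ` arr T X U = arr T X (sh T H)" if X: "X \<in> \<U>" for X
  proof -
    have [simp]: "X \<in> obj T" using X U_obj by blast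
    have gh: "cmp T X U (sh T H) h (cmp T X W U g x) = zero_mor T X (sh T H)" if "x \<in> arr T X W" for x
      using that tri_cmp_zero[OF tri_rotated[OF tri]] by (simp add: cmp_assoc cmp_zero_left)
    have lift: "\<exists>x' \<in> arr T X W. cmp T X W U g x' = x"
      if "x \<in> arr T X U" "cmp T X U (sh T H) h x = zero_mor T X (sh T H)" for x
      using tri_lift[OF tri_rotated[OF tri], of X x] that by auto
    have gen: "\<exists>x' \<in> arr T X U. cmp T X U (sh T H) h x' = x" if "x \<in> arr T X (sh T H)" for x
      using generator_lift[OF tri _ X that] WU by blast
    have "post_comp T \<U> W U g X ` arr T X W = kernel (Mor T X U) (Mor T X (sh T H)) (post_comp T \<U>
        U (sh T H) h X)"
      using X gh lift by (fastforce simp: post_comp_def kernel_def image_iff)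
    moreover have "post_comp T \<U> U (sh T H) h X ` arr T X U = arr T X (sh T H)"
      using X gen by (fastforce simp: post_comp_def image_iff)
    ultimately show ?thesis ..
  qed
  then show ?thesis
    unfolding finitely_presented_def representable_full_subcat
    by (intro conjI bexI[of _ W] bexI[of _ U] bexI[of _ "post_comp T \<U> W U g"]
        bexI[of _ "post_comp T \<U> U (sh T H) h"])
      (use WU U_subset in \<open>simp_all add: representable_presheaf post_comp_map,
        simp_all add: full_subcat_def representable_def\<close>)
qed

text \<open>
  Exactness in the middle holds for every \<open>H\<close>. For injectivity, a map \<open>x : X \<rightarrow> H[1]\<close> killed by \<open>p\<close> comes
  along \<open>X \<rightarrow> Z[1]\<close> from some \<open>Z \<rightarrow> H\<close>. The latter factors through the core, so \<open>x\<close> factors through a map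
  from \<open>X \<in> \<U>\<close> to \<open>W[1]\<close>, which is zero.
\<close>

lemma left_exact_of_T_plus:
  assumes H: "H \<in> T_plus T \<U> \<V>"
  shows "left_exact T \<U> (representable T (sh T H))"
  unfolding left_exact_def
proof (intro allI impI)
  fix Z Y X i p assume "conflation T \<U> Z Y X i p"
  then obtain d where UZ: "Z \<in> \<U>" "Y \<in> \<U>" "X \<in> \<U>" and tri: "tri T Z Y X i p d"
    by (auto simp: conflation_def)
  have [simp]: "H \<in> obj T" by (rule T_plus_obj[OF H])
  note [simp] = tri_closed[OF tri] closure_rules
  have mono: "x = zero_mor T X (sh T H)"
    if x[simp]: "x \<in> arr T X (sh T H)" and xp: "cmp T Y X (sh T H) x p = zero_mor T Y (sh T H)" for x
  proof -
    obtain y where y: "y \<in> arr T (sh T Z) (sh T H)" "cmp T X (sh T Z) (sh T H) y d = x"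
      using tri_extend[OF tri_rotated[OF tri] _ x xp] by auto
    obtain y' where y': "y' \<in> arr T Z H" "sh_mor T Z H y' = y" using sh_full[of Z H y] y by auto
    obtain W w v where W: "W \<in> \<U> \<inter> \<V>" and [simp]: "w \<in> arr T W H" "v \<in> arr T Z W" and wv: "cmp T Z W H w v = y'"
      using T_plus_factor[OF H UZ(1) y'(1)] .
    have [simp]: "W \<in> obj T" using W U_obj by blast
    have "cmp T X (sh T Z) (sh T W) (sh_mor T Z W v) d = zero_mor T X (sh T W)"
      using W UZ by (intro orthogonal) auto
    then have "cmp T X (sh T Z) (sh T H) (sh_mor T Z H (cmp T Z W H w v)) d = zero_mor T X (sh T H)"
      by (simp add: sh_cmp cmp_assoc[symmetric] cmp_zero_right)
    then show ?thesis using y y' wv by simp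
  qed
  have "inj_on (\<lambda>x. cmp T Y X (sh T H) x p) (arr T X (sh T H))"
  proof (rule inj_onI)
    fix x x' assume x[simp]: "x \<in> arr T X (sh T H)" "x' \<in> arr T X (sh T H)"
      and "cmp T Y X (sh T H) x p = cmp T Y X (sh T H) x' p"
    then have "cmp T Y X (sh T H) (x \<otimes>\<^bsub>Mor T X (sh T H)\<^esub> neg_mor T X (sh T H) x') p = zero_mor T Y (sh T H)"
      by (simp add: cmp_add_left cmp_neg_left group_Mor group.r_inv)
    then have "x \<otimes>\<^bsub>Mor T X (sh T H)\<^esub> neg_mor T X (sh T H) x' = zero_mor T X (sh T H)"
      by (rule mono[rotated]) simp
    then show "x = x'" by (simp add: diff_zero_iff)
  qed
  moreover have "cmp T Z Y (sh T H) (cmp T Y X (sh T H) x p) i = zero_mor T Z (sh T H)" if "x \<in>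
      arr T X (sh T H)" for x
    using that tri_cmp_zero[OF tri] by (simp add: cmp_assoc[symmetric] cmp_zero_right)
  moreover have "\<exists>x \<in> arr T X (sh T H). cmp T Y X (sh T H) x p = y"
    if "y \<in> arr T Y (sh T H)" "cmp T Z Y (sh T H) y i = zero_mor T Z (sh T H)" for y
    using tri_extend[OF tri _ that] by auto
  ultimately show "inj_on (fmor (representable T (sh T H)) X Y p) (carrier (fob (representable T (sh T H)) X)) \<and>
    fmor (representable T (sh T H)) X Y p ` carrier (fob (representable T (sh T H)) X) =
    kernel (fob (representable T (sh T H)) Y) (fob (representable T (sh T H)) Z) (fmor
        (representable T (sh T H)) Y Z i)"
    by (fastforce simp: representable_def kernel_def inj_on_def image_iff)
qed

end

section \<open>Every left exact functor comes from the heart\<close>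

context triangulated_category
begin

text \<open>
  Any map \<open>S \<rightarrow> B[1]\<close> is the class of an extension of \<open>S\<close> by \<open>B\<close>.
\<close>

lemma tri_complete_third:
  assumes [simp]: "S \<in> obj T" "B \<in> obj T" and w[simp]: "w \<in> arr T S (sh T B)"
  obtains Y f g where "tri T B Y S f g w"
proof -
  obtain D c d where tri: "tri T S (sh T B) D w c d"
    using tri_complete[of S "sh T B" w] sh_obj by auto
  note [simp] = tri_closed[OF tri] closure_rules
  obtain Y where [simp]: "Y \<in> obj T" and "isomorphic T (sh T Y) D"
    using equivalence_essentially_surjective[OF shift_equivalence, of D] by auto
  then obtain t s where [simp]: "t \<in> arr T (sh T Y) D" "s \<in> arr T D (sh T Y)" and s: "is_iso T D (sh T Y) s"
    and ts: "cmp T D (sh T Y) D t s = ident T D"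
    by (auto simp: isomorphic_def is_iso_def)
  have "tri T S (sh T B) (sh T Y) w (cmp T (sh T B) D (sh T Y) s c) (cmp T (sh T Y) D (sh T S) d t)"
    by (rule tri_iso[OF tri _ _ _ _ _ _ is_iso_ident is_iso_ident s])
      (simp_all add: cmp_ident_left cmp_ident_right sh_ident cmp_assoc[symmetric] ts)
  then obtain f g where "tri T B Y S f g w"
    by (rule tri_unrotate_twice) simp_all
  then show thesis by (rule that)
qed

end

context cotorsion
begin

text \<open>
  The resolution \<open>H \<rightarrow> B \<rightarrow> C\<close> may start with any \<open>B \<in> \<U>\<close>: embedding \<open>B\<close> into the core replaces \<open>C\<close> by an
  extension of objects of \<open>\<U>\<close>.
\<close>

lemma T_minus_of_U_resolution:
  assumes tri: "tri T H B C f g h" and BC: "B \<in> \<U>" "C \<in> \<U>"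
  shows "H \<in> T_minus T \<U> \<V>"
proof -
  obtain W Q e q r where W: "W \<in> \<U> \<inter> \<V>" "Q \<in> \<U>" and tri': "tri T B W Q e q r"
    using embed_in_core[OF BC(1)] .
  have "cmp T H B W e f \<in> arr T H W"
    using tri_closed[OF tri] tri_closed[OF tri'] cmp_closed by blast
  then obtain E h1 h2 where tri'': "tri T H W E (cmp T H B W e f) h1 h2"
    using tri_complete[of H W] tri_closed[OF tri] tri_closed[OF tri'] by blast
  obtain u v w where "tri T C E Q u v w"
    using octahedral[OF tri tri' tri''] by blast
  then have "E \<in> \<U>" using U_extension_closed BC W by blast
  then show ?thesis using T_minusI[OF W(1) _ tri''] by blast
qed

text \<open>
  The object \<open>X\<close> is the fibre of the presentation \<open>a : U\<^sub>1 \<rightarrow> U\<^sub>0\<close>, and \<open>U\<^sub>X \<rightarrow> X\<close> its approximation. With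
  \<open>U\<^sub>X \<rightarrow> W \<rightarrow> Z[1]\<close> an embedding into the core, \<open>H\<close> is the cone of \<open>Z \<rightarrow> U\<^sub>X \<rightarrow> X\<close>, the pushout of \<open>X\<close> along
  \<open>U\<^sub>X \<rightarrow> W\<close>. Maps from \<open>\<U>\<close> to \<open>X\<close> all come from \<open>U\<^sub>X\<close>, and this makes them factor through \<open>W\<close> once
  they are composed with \<open>X \<rightarrow> H\<close>.
\<close>

lemma essentially_surjective:
  assumes fp: "finitely_presented (full_subcat T \<U>) F" and lex: "left_exact T \<U> F"
  shows "\<exists>H \<in> T_plus T \<U> \<V> \<inter> T_minus T \<U> \<V>.
    isomorphic (functor_cat (op_cat (full_subcat T \<U>)) Ab) (representable T (sh T H)) F"
proof -
  have obU: "obj (full_subcat T \<U>) = \<U>" "Mor (full_subcat T \<U>) = Mor T" by (simp_all add: full_subcat_def)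
  have F: "presheaf_on T \<U> F" using fp by (simp add: finitely_presented_def)
  obtain U1 U0 \<alpha> \<pi> where U1: "U1 \<in> \<U>" and U0: "U0 \<in> \<U>"
    and \<alpha>: "\<alpha> \<in> presheaf_maps T \<U> (representable T U1) (representable T U0)"
    and \<pi>: "\<pi> \<in> presheaf_maps T \<U> (representable T U0) F"
    and presentation: "\<forall>X \<in> \<U>. \<alpha> X ` arr T X U1 = kernel (Mor T X U0) (fob F X) (\<pi> X) \<and>
        \<pi> X ` arr T X U0 = carrier (fob F X)"
    using fp unfolding finitely_presented_def representable_full_subcat obU
    by (elim conjE bexE) (rule that)
  have exact: "\<alpha> X ` arr T X U1 = kernel (Mor T X U0) (fob F X) (\<pi> X)"
    and epi: "\<pi> X ` arr T X U0 = carrier (fob F X)" if "X \<in> \<U>" for X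
    using presentation that by simp_all
  note [simp] = closure_rules
  have [simp]: "U1 \<in> obj T" "U0 \<in> obj T" using U1 U0 U_obj by auto
  have \<pi>_in: "\<pi> X u \<in> carrier (fob F X)" if "X \<in> \<U>" "u \<in> arr T X U0" for X u
    using presheaf_mapD(2)[OF \<pi> that(1)] that by (simp add: representable_def)
  have \<pi>_nat: "\<pi> Y (cmp T Y X U0 u f) = fmor F X Y f (\<pi> X u)"
    if "X \<in> \<U>" "Y \<in> \<U>" "f \<in> arr T Y X" "u \<in> arr T X U0" for X Y u f
    using presheaf_mapD(3)[OF \<pi> that(1-3)] that by (simp add: representable_def)
  have \<pi>_hom: "group_hom (Mor T X U0) (fob F X) (\<pi> X)" if "X \<in> \<U>" for X
    using presheaf_map_group_hom[OF \<pi> representable_presheaf F that] by (simp add: U_subset representable_def)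
  have F_hom: "group_hom (fob F X) (fob F Y) (fmor F X Y f)" if "X \<in> \<U>" "Y \<in> \<U>" "f \<in> arr T Y X" for X Y f
    using presheaf_group_hom[OF F that] .
  have F_kernel: "\<exists>\<phi> \<in> carrier (fob F X). fmor F X Y p \<phi> = \<psi>"
    if "conflation T \<U> Z Y X i p" "\<psi> \<in> carrier (fob F Y)" "fmor F Y Z i \<psi> = \<one>\<^bsub>fob F Z\<^esub>" for Z Y X i p \<psi>
  proof -
    have "\<psi> \<in> fmor F X Y p ` carrier (fob F X)"
      using lex that unfolding left_exact_def kernel_def by blast
    then show ?thesis by blast
  qed
  have F_inj: "inj_on (fmor F X Y p) (carrier (fob F X))" if "conflation T \<U> Z Y X i p" for Z Y X i p
    using lex that unfolding left_exact_def by blast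

  define a where "a = \<alpha> U1 (ident T U1)"
  have [simp]: "a \<in> arr T U1 U0"
    using presheaf_mapD(2)[OF \<alpha> U1, of "ident T U1"] by (simp add: a_def representable_def)
  have \<alpha>_eq: "\<alpha> X g = cmp T X U1 U0 a g" if X: "X \<in> \<U>" and g: "g \<in> arr T X U1" for X g
    using presheaf_mapD(3)[OF \<alpha> U1 X g, of "ident T U1"] g U_obj[OF X]
    by (simp add: a_def[symmetric] representable_def cmp_ident_left)
  have \<pi>_zero: "\<pi> X u = \<one>\<^bsub>fob F X\<^esub> \<longleftrightarrow> (\<exists>g \<in> arr T X U1. cmp T X U1 U0 a g = u)"
    if X: "X \<in> \<U>" and u: "u \<in> arr T X U0" for X u
  proof -
    have "\<pi> X u = \<one>\<^bsub>fob F X\<^esub> \<longleftrightarrow> u \<in> \<alpha> X ` arr T X U1"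
      using exact[OF X] u by (auto simp: kernel_def)
    then show ?thesis using \<alpha>_eq[OF X] by (auto simp: image_iff)
  qed
  have \<pi>_a: "\<pi> U1 a = \<one>\<^bsub>fob F U1\<^esub>"
    using \<pi>_zero[OF U1, of a] cmp_ident_right[of U1 U0 a] ident_closed[of U1] by auto

  obtain C c0 d where "tri T U1 U0 C a c0 d" using tri_complete[of U1 U0 a] by auto
  from tri_unrotate[OF this] obtain X x c where tri_a: "tri T X U1 U0 x a c" by metis
  note [simp] = tri_closed[OF tri_a]
  obtain UX V m n o' where UX: "UX \<in> \<U>" and V: "V \<in> \<V>" and tri_m: "tri T UX X (sh T V) m n o'"
    by (rule approximation[of X]) simp_all
  note [simp] = tri_closed[OF tri_m]
  obtain W Q e q0 r where W: "W \<in> \<U> \<inter> \<V>" and Q: "Q \<in> \<U>" and tri_e: "tri T UX W Q e q0 r"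
    using embed_in_core[OF UX] .
  obtain Z z s where tri_z: "tri T Z UX W z e (cmp T W Q (sh T Z) s q0)" and s: "is_iso T Q (sh T Z) s"
    using tri_unrotate[OF tri_e] .
  define q where "q = cmp T W Q (sh T Z) s q0"
  note tri_z = tri_z[folded q_def]
  note [simp] = tri_closed[OF tri_z]
  have sZ: "sh T Z \<in> \<U>" using U_iso[OF Q _ s] by simp
  obtain H j k where tri_H: "tri T Z X H (cmp T Z UX X m z) j k"
    using tri_complete[of Z X "cmp T Z UX X m z"] by auto
  note [simp] = tri_closed[OF tri_H]
  \<comment> \<open>The octahedron on \<open>Z \<rightarrow> UX \<rightarrow> X\<close> exhibits \<open>H\<close> as an extension of \<open>V[1]\<close> by \<open>W\<close>.\<close>
  obtain t v where [simp]: "t \<in> arr T W H" and kt: "cmp T W H (sh T Z) k t = q"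
    and tri_t: "\<exists>w. tri T W H (sh T V) t v w"
    using octahedral[OF tri_z tri_m tri_H] by metis
  have H_plus: "H \<in> T_plus T \<U> \<V>" using T_plusI[OF W V] tri_t by blast
  obtain B l p where tri_B: "tri T Z U1 B (cmp T Z X U1 x (cmp T Z UX X m z)) l p"
    using tri_complete[of Z U1 "cmp T Z X U1 x (cmp T Z UX X m z)"] by auto
  note [simp] = tri_closed[OF tri_B]
  \<comment> \<open>The octahedron on \<open>Z \<rightarrow> X \<rightarrow> U1\<close>: the map \<open>b\<close> extends \<open>a\<close>, and \<open>H\<close> is its fibre.\<close>
  obtain y b where [simp]: "y \<in> arr T H B" "b \<in> arr T B U0" and py: "cmp T H B (sh T Z) p y = k"
    and bl: "cmp T U1 B U0 b l = a" and tri_y: "\<exists>\<delta>. tri T H B U0 y b \<delta>"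
    using octahedral[OF tri_H tri_a tri_B] by metis
  obtain \<delta> where tri_b: "tri T H B U0 y b \<delta>" using tri_y by blast
  note [simp] = tri_closed[OF tri_b]
  have B: "B \<in> \<U>" using U_extension_closed[OF tri_rotated[OF tri_B] U1 sZ] .
  have H_minus: "H \<in> T_minus T \<U> \<V>" by (rule T_minus_of_U_resolution[OF tri_b B U0])

  \<comment> \<open>Enlarging \<open>U1\<close> to \<open>B\<close> adds no relations to \<open>F\<close>. As \<open>\<pi> b\<close> vanishes on \<open>U1\<close>, it comes from some
    \<open>\<phi> \<in> F(Z[1])\<close>; and \<open>\<phi>\<close> vanishes on \<open>W\<close>, because \<open>b\<close> does: there \<open>W \<rightarrow> B\<close> factors through \<open>H\<close>.
    But \<open>F(Z[1]) \<rightarrow> F(W)\<close> is injective.\<close>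
  have \<pi>_b: "\<pi> B b = \<one>\<^bsub>fob F B\<^esub>"
  proof -
    have conf: "conflation T \<U> U1 B (sh T Z) l p"
      using tri_rotated[OF tri_B] U1 B sZ unfolding conflation_def by blast
    have "fmor F B U1 l (\<pi> B b) = \<one>\<^bsub>fob F U1\<^esub>"
      using \<pi>_nat[OF B U1, of l b] by (simp add: bl \<pi>_a)
    from F_kernel[OF conf \<pi>_in[OF B] this]
    obtain \<phi> where \<phi>: "\<phi> \<in> carrier (fob F (sh T Z))" "fmor F (sh T Z) B p \<phi> = \<pi> B b"
      by auto
    have WU: "W \<in> \<U>" using W by simp
    have "cmp T W B (sh T Z) p (cmp T W H B y t) = q"
      by (simp add: cmp_assoc py kt)
    then have "fmor F (sh T Z) W q \<phi> = fmor F B W (cmp T W H B y t) (fmor F (sh T Z) B p \<phi>)"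
      using presheafD(4)[OF F sZ B WU _ _ \<phi>(1), of p "cmp T W H B y t"] by simp
    also have "\<dots> = \<pi> W (cmp T W B U0 b (cmp T W H B y t))"
      using \<pi>_nat[OF B WU, of "cmp T W H B y t" b] by (simp add: \<phi>(2))
    also have "\<dots> = \<one>\<^bsub>fob F W\<^esub>"
      using tri_cmp_zero[OF tri_b] group_hom.hom_one[OF \<pi>_hom[OF WU]] by (simp add: cmp_assoc cmp_zero_left)
    finally have "fmor F (sh T Z) W q \<phi> = fmor F (sh T Z) W q \<one>\<^bsub>fob F (sh T Z)\<^esub>"
      using group_hom.hom_one[OF F_hom[OF sZ WU, of q]] by simp
    moreover have "conflation T \<U> UX W (sh T Z) e q"
      using tri_rotated[OF tri_z] UX WU sZ unfolding conflation_def by blast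
    moreover have "\<one>\<^bsub>fob F (sh T Z)\<^esub> \<in> carrier (fob F (sh T Z))"
      using presheafD(1)[OF F sZ] by (simp add: comm_group_def group.is_monoid monoid.one_closed)
    ultimately have "\<phi> = \<one>\<^bsub>fob F (sh T Z)\<^esub>"
      using F_inj \<phi>(1) by (meson inj_onD)
    then show ?thesis
      using \<phi>(2) group_hom.hom_one[OF F_hom[OF sZ B, of p]] by simp
  qed

  have kernels: "cmp T S U0 (sh T H) \<delta> u = zero_mor T S (sh T H) \<longleftrightarrow> \<pi> S u = \<one>\<^bsub>fob F S\<^esub>"
    if S: "S \<in> \<U>" and u[simp]: "u \<in> arr T S U0" for S u
  proof -
    have [simp]: "S \<in> obj T" using S U_obj by blast
    show ?thesis
    proof
      assume "cmp T S U0 (sh T H) \<delta> u = zero_mor T S (sh T H)"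
      then obtain g where g: "g \<in> arr T S B" "cmp T S B U0 b g = u"
        using tri_lift[OF tri_rotated[OF tri_b], of S u] by auto
      then have "\<pi> S u = fmor F B S g \<one>\<^bsub>fob F B\<^esub>"
        using \<pi>_nat[OF B S, of g b] by (simp add: \<pi>_b)
      then show "\<pi> S u = \<one>\<^bsub>fob F S\<^esub>"
        using group_hom.hom_one[OF F_hom[OF B S g(1)]] by simp
    next
      assume "\<pi> S u = \<one>\<^bsub>fob F S\<^esub>"
      then obtain g where [simp]: "g \<in> arr T S U1" and g: "cmp T S U1 U0 a g = u"
        using \<pi>_zero[OF S u] by blast
      have "cmp T S U0 (sh T H) \<delta> (cmp T S U1 U0 (cmp T U1 B U0 b l) g) =
        cmp T S U1 (sh T H) (cmp T U1 B (sh T H) (cmp T B U0 (sh T H) \<delta> b) l) g"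
        by (simp add: cmp_assoc)
      then show "cmp T S U0 (sh T H) \<delta> u = zero_mor T S (sh T H)"
        using tri_cmp_zero[OF tri_rotated[OF tri_b]] by (simp add: bl g cmp_zero_left)
    qed
  qed

  \<comment> \<open>A map \<open>x0 : S \<rightarrow> H[1]\<close> lifts to \<open>U0\<close> after pulling back to the extension \<open>Y\<close> of \<open>S\<close> by \<open>B\<close> that it defines.
    The class in \<open>F(Y)\<close> of such a lift \<open>w\<close> vanishes on \<open>B\<close>, so it descends to \<open>F(S)\<close> and is represented
    by some \<open>u : S \<rightarrow> U0\<close>. Then \<open>u\<close> and \<open>x0\<close> agree on \<open>Y\<close>, hence on \<open>S\<close>.\<close>
  have surj: "\<exists>u \<in> arr T S U0. cmp T S U0 (sh T H) \<delta> u = x0"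
    if S: "S \<in> \<U>" and x0[simp]: "x0 \<in> arr T S (sh T H)" for S x0
  proof -
    have [simp]: "S \<in> obj T" using S U_obj by blast
    let ?y = "neg_mor T (sh T H) (sh T B) (sh_mor T H B y)"
    obtain Y f g where tri_Y: "tri T B Y S f g (cmp T S (sh T H) (sh T B) ?y x0)"
      using tri_complete_third[of S B "cmp T S (sh T H) (sh T B) ?y x0"] by auto
    note [simp] = tri_closed[OF tri_Y]
    have Y: "Y \<in> \<U>" using U_extension_closed[OF tri_Y B S] .
    have conf: "conflation T \<U> B Y S f g" using B Y S tri_Y unfolding conflation_def by blast
    have "cmp T Y (sh T H) (sh T B) ?y (cmp T Y S (sh T H) x0 g) = zero_mor T Y (sh T B)"
      using tri_cmp_zero[OF tri_rotated[OF tri_Y]] by (simp add: cmp_assoc)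
    then obtain w where [simp]: "w \<in> arr T Y U0" and w: "cmp T Y U0 (sh T H) \<delta> w = cmp T Y S (sh T H) x0 g"
      using tri_lift[OF tri_rotated[OF tri_rotated[OF tri_b]], of Y "cmp T Y S (sh T H) x0 g"] by auto
    have "cmp T B U0 (sh T H) \<delta> (cmp T B Y U0 w f) = cmp T B S (sh T H) x0 (cmp T B Y S g f)"
      by (simp add: cmp_assoc w)
    then have "cmp T B U0 (sh T H) \<delta> (cmp T B Y U0 w f) = zero_mor T B (sh T H)"
      by (simp add: tri_cmp_zero[OF tri_Y] cmp_zero_right)
    then have "\<pi> B (cmp T B Y U0 w f) = \<one>\<^bsub>fob F B\<^esub>" using kernels[OF B] by simp
    then have "fmor F Y B f (\<pi> Y w) = \<one>\<^bsub>fob F B\<^esub>"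
      using \<pi>_nat[OF Y B, of f w] by simp
    from F_kernel[OF conf \<pi>_in[OF Y] this]
    obtain \<psi> where "\<psi> \<in> carrier (fob F S)" and \<psi>: "fmor F S Y g \<psi> = \<pi> Y w"
      by auto
    then obtain u where [simp]: "u \<in> arr T S U0" and u: "\<psi> = \<pi> S u"
      using epi[OF S] by blast
    interpret pY: group_hom "Mor T Y U0" "fob F Y" "\<pi> Y" by (rule \<pi>_hom[OF Y])
    have "\<pi> Y (cmp T Y S U0 u g) = \<pi> Y w"
      using \<pi>_nat[OF S Y, of g u] \<psi> u by simp
    then have "\<pi> Y (cmp T Y S U0 u g \<otimes>\<^bsub>Mor T Y U0\<^esub> neg_mor T Y U0 w) = \<one>\<^bsub>fob F Y\<^esub>"
      by simp
    then have "cmp T Y U0 (sh T H) \<delta> (cmp T Y S U0 u g \<otimes>\<^bsub>Mor T Y U0\<^esub> neg_mor T Y U0 w) = zero_mor T Y (sh T H)"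
      using kernels[OF Y] by simp
    then have "cmp T Y U0 (sh T H) \<delta> (cmp T Y S U0 u g) = cmp T Y U0 (sh T H) \<delta> w"
      by (simp add: cmp_add_right cmp_neg_right diff_zero_iff)
    then have "cmp T Y S (sh T H) (cmp T S U0 (sh T H) \<delta> u) g = cmp T Y S (sh T H) x0 g"
      by (simp add: cmp_assoc w)
    moreover have "inj_on (\<lambda>x. cmp T Y S (sh T H) x g) (arr T S (sh T H))"
      using left_exact_of_T_plus[OF H_plus] conf unfolding left_exact_def
      by (fastforce simp: representable_def inj_on_def)
    ultimately have "cmp T S U0 (sh T H) \<delta> u = x0"
      by (auto dest: inj_onD)
    then show ?thesis using \<open>u \<in> arr T S U0\<close> by blast
  qed

  have "isomorphic (functor_cat (op_cat (full_subcat T \<U>)) Ab) (representable T (sh T H)) F"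
  proof (rule isomorphic_of_equal_kernels)
    show "presheaf_on T \<U> (representable T U0)" "presheaf_on T \<U> (representable T (sh T H))" "presheaf_on T \<U> F"
      using F by (simp_all add: representable_presheaf U_subset)
    show "post_comp T \<U> U0 (sh T H) \<delta> \<in> presheaf_maps T \<U> (representable T U0) (representable T (sh T H))"
      by (simp add: post_comp_map U_subset)
    show "\<pi> \<in> presheaf_maps T \<U> (representable T U0) F" by (rule \<pi>)
    fix S assume S: "S \<in> \<U>"
    show "carrier (fob (representable T (sh T H)) S) \<subseteq> post_comp T \<U> U0 (sh T H) \<delta> S ` carrier
        (fob (representable T U0) S)"
      using surj[OF S] S by (fastforce simp: representable_def post_comp_def image_iff)
    show "carrier (fob F S) \<subseteq> \<pi> S ` carrier (fob (representable T U0) S)"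
      using epi[OF S] by (simp add: representable_def)
    fix u assume "u \<in> carrier (fob (representable T U0) S)"
    then show "post_comp T \<U> U0 (sh T H) \<delta> S u = \<one>\<^bsub>fob (representable T (sh T H)) S\<^esub> \<longleftrightarrow> \<pi> S u = \<one>\<^bsub>fob F S\<^esub>"
      using kernels[OF S] S by (simp add: representable_def post_comp_def)
  qed
  then show ?thesis using H_plus H_minus by blast
qed

lemma lex_cat_simps:
  shows "obj (lex_cat T \<U>) = {F. finitely_presented (full_subcat T \<U>) F \<and> left_exact T \<U> F}"
    and "Mor (lex_cat T \<U>) = Mor (functor_cat (op_cat (full_subcat T \<U>)) Ab)"
    and "ident (lex_cat T \<U>) = ident (functor_cat (op_cat (full_subcat T \<U>)) Ab)"
    and "cmp (lex_cat T \<U>) = cmp (functor_cat (op_cat (full_subcat T \<U>)) Ab)"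
    and "arr (functor_cat (op_cat (full_subcat T \<U>)) Ab) F G = presheaf_maps T \<U> F G"
  by (simp_all add: lex_cat_def mod_cat_def full_subcat_def functor_cat_def)

lemma lex_cat_preadditive: "preadditive_category (lex_cat T \<U>)"
  unfolding lex_cat_def mod_cat_def
proof (intro preadditive_category.full_subcat_preadditive functor_cat_preadditive Ab_preadditive)
  show "{F. finitely_presented (full_subcat T \<U>) F} \<subseteq> obj (functor_cat (op_cat (full_subcat T \<U>)) Ab)"
    by (auto simp: finitely_presented_def functor_cat_def)
qed blast

lemma heart_equivalent_lex: "equivalent_categories (heart T \<U> \<V>) (lex_cat T \<U>)"
  unfolding heart_def
proof (rule quotient_equivalence)
  let ?H = "T_plus T \<U> \<V> \<inter> T_minus T \<U> \<V>"
  let ?\<Phi> = "\<lparr>fob = (\<lambda>H. representable T (sh T H)),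
    fmor = (\<lambda>H H' f. post_comp T \<U> (sh T H) (sh T H') (sh_mor T H H' f))\<rparr>"
  have H: "H \<in> T_plus T \<U> \<V>" "H \<in> T_minus T \<U> \<V>" "H \<in> obj T" "sh T H \<in> obj T"
    if "H \<in> obj (full_subcat T ?H)" for H
    using that T_minus_obj sh_obj by (auto simp: full_subcat_def)
  note [simp] = H U_subset
  have arr: "arr (full_subcat T ?H) X Y = arr T X Y" and ident: "ident (full_subcat T ?H) = ident T"
    and cmp: "cmp (full_subcat T ?H) = cmp T" for X Y by (simp_all add: full_subcat_def)
  show "preadditive_category (full_subcat T ?H)"
    using T_minus_obj by (intro full_subcat_preadditive) blast
  show "preadditive_category (lex_cat T \<U>)" by (rule lex_cat_preadditive)
  show "additive_functor (full_subcat T ?H) (lex_cat T \<U>) ?\<Phi>"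
    unfolding additive_functor_def
  proof (intro conjI ballI)
    fix H1 H2 assume H12: "H1 \<in> obj (full_subcat T ?H)" "H2 \<in> obj (full_subcat T ?H)"
    have MorH: "Mor (full_subcat T ?H) = Mor T" by (simp add: full_subcat_def)
    show "fmor ?\<Phi> H1 H2 \<in> hom (Mor (full_subcat T ?H) H1 H2) (Mor (lex_cat T \<U>) (fob ?\<Phi> H1) (fob ?\<Phi> H2))"
      unfolding MorH lex_cat_simps(2)
    proof (rule homI)
      fix f assume f: "f \<in> arr T H1 H2"
      then show "fmor ?\<Phi> H1 H2 f \<in> arr (functor_cat (op_cat (full_subcat T \<U>)) Ab) (fob ?\<Phi> H1) (fob ?\<Phi> H2)"
        using H12 by (simp add: lex_cat_simps(5) post_comp_map sh_arr)
      fix g assume g: "g \<in> arr T H1 H2"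
      have "sh_mor T H1 H2 (f \<otimes>\<^bsub>Mor T H1 H2\<^esub> g)
          = sh_mor T H1 H2 f \<otimes>\<^bsub>Mor T (sh T H1) (sh T H2)\<^esub> sh_mor T H1 H2 g"
        using group_hom.hom_mult[OF sh_hom f g] H12 by simp
      then show "fmor ?\<Phi> H1 H2 (f \<otimes>\<^bsub>Mor T H1 H2\<^esub> g) = fmor ?\<Phi> H1 H2 f
          \<otimes>\<^bsub>Mor (functor_cat (op_cat (full_subcat T \<U>)) Ab) (fob ?\<Phi> H1) (fob ?\<Phi> H2)\<^esub> fmor ?\<Phi> H1 H2 g"
        using H12 f g by (simp add: post_comp_add sh_arr)
    qed
  next
    fix H1 assume H1: "H1 \<in> obj (full_subcat T ?H)"
    show "fob ?\<Phi> H1 \<in> obj (lex_cat T \<U>)"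
      using finitely_presented_of_T_minus[OF H(2)[OF H1]] left_exact_of_T_plus[OF H(1)[OF H1]]
      by (simp add: lex_cat_simps(1))
    show "fmor ?\<Phi> H1 H1 (ident (full_subcat T ?H) H1) = ident (lex_cat T \<U>) (fob ?\<Phi> H1)"
      using post_comp_ident[OF U_subset H(4)[OF H1]] sh_ident[OF H(3)[OF H1]]
      by (simp add: lex_cat_simps(3) ident)
  next
    fix H1 H2 H3 f g
    assume H123: "H1 \<in> obj (full_subcat T ?H)" "H2 \<in> obj (full_subcat T ?H)" "H3 \<in> obj (full_subcat T ?H)"
      and f: "f \<in> arr (full_subcat T ?H) H1 H2" and g: "g \<in> arr (full_subcat T ?H) H2 H3"
    note o = H123[THEN H(3)]
    note f = f[unfolded arr] and g = g[unfolded arr]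
    show "fmor ?\<Phi> H1 H3 (cmp (full_subcat T ?H) H1 H2 H3 g f)
        = cmp (lex_cat T \<U>) (fob ?\<Phi> H1) (fob ?\<Phi> H2) (fob ?\<Phi> H3) (fmor ?\<Phi> H2 H3 g) (fmor ?\<Phi> H1 H2 f)"
      using post_comp_cmp[OF U_subset o[THEN sh_obj] sh_arr[OF o(1,2) f] sh_arr[OF o(2,3) g]] sh_cmp[OF o f g]
      by (simp add: lex_cat_simps(4) cmp)
  qed
  fix H1 H2 assume H12: "H1 \<in> obj (full_subcat T ?H)" "H2 \<in> obj (full_subcat T ?H)"
  show "factoring (full_subcat T ?H) (\<U> \<inter> \<V>) H1 H2 =
      kernel (Mor (full_subcat T ?H) H1 H2) (Mor (lex_cat T \<U>) (fob ?\<Phi> H1) (fob ?\<Phi> H2)) (fmor ?\<Phi> H1 H2)"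
  proof -
    have one: "post_comp T \<U> (sh T H1) (sh T H2) k = \<one>\<^bsub>Mor (lex_cat T \<U>) (representable T (sh T
        H1)) (representable T (sh T H2))\<^esub>
      \<longleftrightarrow> (\<forall>X \<in> \<U>. \<forall>x \<in> arr T X (sh T H1). cmp T X (sh T H1) (sh T H2) k x = zero_mor T X (sh T H2))"
      (is "?p = ?o \<longleftrightarrow> ?z") for k
    proof -
      have o: "?o = (\<lambda>X\<in>\<U>. \<lambda>x\<in>arr T X (sh T H1). zero_mor T X (sh T H2))"
        by (simp add: lex_cat_simps functor_cat_def op_cat_def full_subcat_def Ab_def
            representable_def cong: restrict_cong)
      show ?thesis
      proof
        assume "?p = ?o"
        then have eq: "?p X x = (\<lambda>X\<in>\<U>. \<lambda>x\<in>arr T X (sh T H1). zero_mor T X (sh T H2)) X x" for X x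
          unfolding o by simp
        show ?z
        proof (intro ballI)
          fix X x assume "X \<in> \<U>" "x \<in> arr T X (sh T H1)"
          with eq[of X x] show "cmp T X (sh T H1) (sh T H2) k x = zero_mor T X (sh T H2)"
            by (simp add: post_comp_def)
        qed
      next
        assume ?z
        then show "?p = ?o" unfolding o by (simp add: post_comp_def cong: restrict_cong)
      qed
    qed
    have "factoring T (\<U> \<inter> \<V>) H1 H2 \<subseteq> arr T H1 H2"
      using U_obj H12 by (auto simp: factoring_def cmp_closed)
    then have "f \<in> factoring T (\<U> \<inter> \<V>) H1 H2 \<longleftrightarrow> f \<in> arr T H1 H2 \<and> fmor ?\<Phi> H1 H2 f
        = \<one>\<^bsub>Mor (lex_cat T \<U>) (fob ?\<Phi> H1) (fob ?\<Phi> H2)\<^esub>" for f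
      using post_comp_zero_iff[OF H(2)[OF H12(1)] H(3)[OF H12(2)], of f] one[of "sh_mor T H1 H2 f"]
      by (simp only: acat.simps functr.simps) blast
    moreover have "factoring (full_subcat T ?H) (\<U> \<inter> \<V>) H1 H2 = factoring T (\<U> \<inter> \<V>) H1 H2"
      by (simp add: factoring_def full_subcat_def)
    ultimately show ?thesis by (simp add: Set.set_eq_iff kernel_def arr)
  qed
  fix \<eta> assume "\<eta> \<in> arr (lex_cat T \<U>) (fob ?\<Phi> H1) (fob ?\<Phi> H2)"
  then show "\<exists>f \<in> arr (full_subcat T ?H) H1 H2. fmor ?\<Phi> H1 H2 f = \<eta>"
    using post_comp_full[of H1 H2 \<eta>] H12 by (simp add: lex_cat_simps arr)
next
  fix F assume "F \<in> obj (lex_cat T \<U>)"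
  then show "\<exists>H \<in> obj (full_subcat T (T_plus T \<U> \<V> \<inter> T_minus T \<U> \<V>)). isomorphic (lex_cat T \<U>)
      (fob \<lparr>fob = (\<lambda>H. representable T (sh T H)),
        fmor = (\<lambda>H H' f. post_comp T \<U> (sh T H) (sh T H') (sh_mor T H H' f))\<rparr> H) F"
    using essentially_surjective[of F]
    by (auto simp: lex_cat_simps isomorphic_def is_iso_def full_subcat_def[of T "T_plus T \<U> \<V> \<inter> T_minus T \<U> \<V>"])
qed

end

theorem theorem2:
  fixes T :: "('o, 'm) tcat" and \<U> \<V> :: "'o set"
  assumes "triangulated_category T"
    and "cotorsion_pair T \<U> \<V>"
  shows "equivalent_categories (heart T \<U> \<V>) (lex_cat T \<U>)"
proof -
  interpret cotorsion T \<U> \<V>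
    using assms by (simp add: cotorsion_def cotorsion_axioms_def)
  show ?thesis by (rule heart_equivalent_lex)
qed

end
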